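(* The point $p=1/4$ is an accumulation point of the hereditary property $\mathrm{Forb}\bigl(\{K_{1,4},C_5,C_6,C_7,\ldots\}\bigr)$, where $C_m$ denotes the cycle on $m$ vertices (so the forbidden family consists of $K_{1,4}$ and all cycles $C_m$ with $m\ge 5$).
   Context: All graphs are finite and simple. For a family $\mathcal F$ of graphs, $\mathrm{Forb}(\mathcal F)$ is the family of all graphs containing no member of $\mathcal F$ as an induced subgraph. A hereditary property is a family of graphs closed under isomorphism and vertex-deletion (each is of the form $\mathrm{Forb}(\mathcal F)$); it is non-trivial if it contains graphs of unbounded order (and then it contains graphs of every order). Edit distance function. For graphs $G,H$ on the same vertex set $V$, $\mathrm{dist}(G,H)=|E(G)\triangle E(H)|/\binom{|V|}{2}$. For a non-trivial hereditary property $\mathcal H$, $\mathrm{dist}(G,\mathcal H)=\min\{\mathrm{dist}(G,H):H\in\mathcal H,\ V(H)=V(G)\}$, and $$\mathrm{ed}_{\mathcal H}(p)=\limsup_{n\to\infty}\max\Bigl\{\mathrm{dist}(G,\mathcal H):|V(G)|=n,\ |E(G)|=\Bigl\lfloor p\tbinom n2\Bigr\rfloor\Bigr\},\qquad p\in[0,1].$$ CRGs. A colored regularity graph (CRG) $K$ is a finite non-empty clique together with a partition of its vertices into black and white, $V(K)=VB(K)\sqcup VW(K)$, and a partition of its edges into black, white and gray, $E(K)=EB(K)\sqcup EW(K)\sqcup EG(K)$. For a graph $F$, write $F\mapsto K$ if there is a function $\phi\colon V(F)\to V(K)$ such that: for every $uv\in E(F)$, either $\phi(u)=\phi(v)\in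 VB(K)$ or $\phi(u)\phi(v)\in EB(K)\cup EG(K)$; and for every pair of distinct $u,v$ with $uv\notin E(F)$, either $\phi(u)=\phi(v)\in VW(K)$ or $\phi(u)\phi(v)\in EW(K)\cup EG(K)$. For a family $\mathcal F$, write $\mathcal F\mapsto K$ if $F\mapsto K$ for some $F\in\mathcal F$, and $\mathcal F\not\mapsto K$ otherwise. For $\mathcal H=\mathrm{Forb}(\mathcal F)$ non-trivial, $\mathcal K(\mathcal H)$ is the set of all CRGs $K$ with $\mathcal F\not\mapsto K$. For $p\in[0,1]$, $M_K(p)\in\mathbb R^{V(K)\times V(K)}$ is the matrix whose $(x,y)$ entry is $p$ if $x=y\in VW(K)$ or $xy\in EW(K)$; $1-p$ if $x=y\in VB(K)$ or $xy\in EB(K)$; and $0$ if $xy\in EG(K)$. Set $g_K(p)=\min\{\langle\mu,M_K(p)\mu\rangle:\mu\in\Delta^K\}$, where $\Delta^K$ is the set of all probability masses on $V(K)$. Accumulation points. Let $\mathcal H$ be a non-trivial hereditary property. A point $p_0\in[0,1]$ is a regular point of $\mathcal H$ if there are $\epsilon>0$ and a finite subset $\mathcal K'\subseteq\mathcal K(\mathcal H)$ such that $\mathrm{ed}_{\mathcal H}(p)=\min_{K\in\mathcal K'}g_K(p)$ for every $p\in(p_0-\epsilon,p_0+\epsilon)\cap[0,1]$. Otherwise $p_0$ is an accumulation point of $\mathcal H$. *)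

theory Defs
  imports "HOL-Analysis.Analysis" "HOL-Library.Ramsey"
begin

section \<open>Finite simple graphs\<close>

text \<open>
  Vertices are natural numbers, so that a family of graphs is a set; every finite simple graph
  has an isomorphic copy of this form. An edge is a two-element set of vertices. The graph without
  vertices is allowed.
\<close>

record graph =
  verts :: "nat set"
  edges :: "nat set set"

definition simple_graph :: "graph \<Rightarrow> bool" where
  "simple_graph G \<longleftrightarrow> finite (verts G) \<and> edges G \<subseteq> nsets (verts G) 2"

definition graph_iso :: "graph \<Rightarrow> graph \<Rightarrow> bool" where
  "graph_iso G H \<longleftrightarrow>
     (\<exists>f. bij_betw f (verts G) (verts H) \<and>
          (\<forall>u\<in>verts G. \<forall>v\<in>verts G. {u, v} \<in> edges G \<longleftrightarrow> {f u, f v} \<in> edges H))"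

definition induced_subgraph :: "graph \<Rightarrow> nat set \<Rightarrow> graph" where
  "induced_subgraph G W = \<lparr>verts = W, edges = {e \<in> edges G. e \<subseteq> W}\<rparr>"

definition contains_induced :: "graph \<Rightarrow> graph \<Rightarrow> bool" where
  "contains_induced G F \<longleftrightarrow> (\<exists>W \<subseteq> verts G. graph_iso F (induced_subgraph G W))"

definition Forb :: "graph set \<Rightarrow> graph set" where
  "Forb \<F> = {G. simple_graph G \<and> (\<forall>F\<in>\<F>. \<not> contains_induced G F)}"

definition hereditary :: "graph set \<Rightarrow> bool" where
  "hereditary \<H> \<longleftrightarrow>
     (\<forall>G\<in>\<H>. simple_graph G) \<and>
     (\<forall>G\<in>\<H>. \<forall>H. simple_graph H \<and> graph_iso G H \<longrightarrow> H \<in> \<H>) \<and>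
     (\<forall>G\<in>\<H>. \<forall>v\<in>verts G. induced_subgraph G (verts G - {v}) \<in> \<H>)"

definition nontrivial :: "graph set \<Rightarrow> bool" where
  "nontrivial \<H> \<longleftrightarrow> (\<forall>n. \<exists>G\<in>\<H>. card (verts G) \<ge> n)"

definition complete_bipartite :: "nat \<Rightarrow> nat \<Rightarrow> graph" where
  "complete_bipartite m n =
     \<lparr>verts = {..<m + n}, edges = {{i, j} | i j. i < m \<and> m \<le> j \<and> j < m + n}\<rparr>"

text \<open>This is the cycle on \<open>m\<close> vertices for \<open>m \<ge> 3\<close> only.\<close>

definition cycle_graph :: "nat \<Rightarrow> graph" where
  "cycle_graph m = \<lparr>verts = {..<m}, edges = {{i, Suc i mod m} | i. i < m}\<rparr>"

section \<open>The edit distance function\<close>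

text \<open>Only meaningful for graphs on the same vertex set.\<close>

definition edit_dist :: "graph \<Rightarrow> graph \<Rightarrow> real" where
  "edit_dist G H =
     real (card ((edges G - edges H) \<union> (edges H - edges G))) / real (card (verts G) choose 2)"

definition edit_dist_to :: "graph \<Rightarrow> graph set \<Rightarrow> real" where
  "edit_dist_to G \<H> = Min (edit_dist G ` {H \<in> \<H>. verts H = verts G})"

text \<open>
  The maximum ranges over infinitely many graphs, but over a finite set of values, since for a
  non-trivial hereditary property all of them lie in \<open>{k / (n choose 2) | k \<le> n choose 2}\<close>.
  For the same reason the upper limit is finite, and no information is lost by
  the conversion from extended reals.
\<close>

definition max_edit_dist :: "graph set \<Rightarrow> real \<Rightarrow> nat \<Rightarrow> real" where
  "max_edit_dist \<H> p n =
     Max ((\<lambda>G. edit_dist_to G \<H>) `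
       {G. simple_graph G \<and> card (verts G) = n \<and>
           int (card (edges G)) = \<lfloor>p * real (n choose 2)\<rfloor>})"

definition ed :: "graph set \<Rightarrow> real \<Rightarrow> real" where
  "ed \<H> p = real_of_ereal (limsup (\<lambda>n. ereal (max_edit_dist \<H> p n)))"

section \<open>Colored regularity graphs\<close>

record crg =
  VB :: "nat set"
  VW :: "nat set"
  EB :: "nat set set"
  EW :: "nat set set"
  EG :: "nat set set"

definition crg_verts :: "crg \<Rightarrow> nat set" where
  "crg_verts K = VB K \<union> VW K"

definition is_crg :: "crg \<Rightarrow> bool" where
  "is_crg K \<longleftrightarrow>
     finite (crg_verts K) \<and> crg_verts K \<noteq> {} \<and> VB K \<inter> VW K = {} \<and>
     EB K \<union> EW K \<union> EG K = nsets (crg_verts K) 2 \<and>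
     EB K \<inter> EW K = {} \<and> EB K \<inter> EG K = {} \<and> EW K \<inter> EG K = {}"

definition maps_to :: "graph \<Rightarrow> crg \<Rightarrow> bool" where
  "maps_to F K \<longleftrightarrow>
     (\<exists>\<phi>. \<phi> ` verts F \<subseteq> crg_verts K \<and>
        (\<forall>u\<in>verts F. \<forall>v\<in>verts F. {u, v} \<in> edges F \<longrightarrow>
           (\<phi> u = \<phi> v \<and> \<phi> u \<in> VB K) \<or> {\<phi> u, \<phi> v} \<in> EB K \<union> EG K) \<and>
        (\<forall>u\<in>verts F. \<forall>v\<in>verts F. u \<noteq> v \<and> {u, v} \<notin> edges F \<longrightarrow>
           (\<phi> u = \<phi> v \<and> \<phi> u \<in> VW K) \<or> {\<phi> u, \<phi> v} \<in> EW K \<union> EG K))"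

definition family_maps_to :: "graph set \<Rightarrow> crg \<Rightarrow> bool" where
  "family_maps_to \<F> K \<longleftrightarrow> (\<exists>F\<in>\<F>. maps_to F K)"

text \<open>
  The set \<open>\<K>(\<H>)\<close> is defined through a family \<open>\<F>\<close> with \<open>\<H> = Forb \<F>\<close>; it does not depend on
  which one, see \<open>admissible_crgs_Forb\<close> below.
\<close>

definition admissible_crgs :: "graph set \<Rightarrow> crg set" where
  "admissible_crgs \<H> =
     {K. is_crg K \<and> (\<exists>\<F>. (\<forall>F\<in>\<F>. simple_graph F) \<and> \<H> = Forb \<F> \<and> \<not> family_maps_to \<F> K)}"

lemma contains_induced_refl:
  assumes "simple_graph G"
  shows "contains_induced G G"
proof -
  have "induced_subgraph G (verts G) = G"
    using assms by (auto simp: induced_subgraph_def simple_graph_def nsets_def intro!: graph.equality)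
  moreover have "graph_iso G G"
    unfolding graph_iso_def by (rule exI[of _ id]) auto
  ultimately show ?thesis
    unfolding contains_induced_def by (intro exI[of _ "verts G"]) auto
qed

lemma maps_to_contains_induced:
  assumes "contains_induced G F" and "maps_to G K"
  shows "maps_to F K"
proof -
  obtain W f where W: "W \<subseteq> verts G" and f: "bij_betw f (verts F) W"
    and e: "\<And>u v. u \<in> verts F \<Longrightarrow> v \<in> verts F \<Longrightarrow>
      {u, v} \<in> edges F \<longleftrightarrow> {f u, f v} \<in> edges G \<and> {f u, f v} \<subseteq> W"
    using assms(1) unfolding contains_induced_def graph_iso_def induced_subgraph_def by auto
  obtain \<phi> where \<phi>: "\<phi> ` verts G \<subseteq> crg_verts K"
    "\<And>u v. u \<in> verts G \<Longrightarrow> v \<in> verts G \<Longrightarrow> {u, v} \<in> edges G \<Longrightarrow>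
       (\<phi> u = \<phi> v \<and> \<phi> u \<in> VB K) \<or> {\<phi> u, \<phi> v} \<in> EB K \<union> EG K"
    "\<And>u v. u \<in> verts G \<Longrightarrow> v \<in> verts G \<Longrightarrow> u \<noteq> v \<Longrightarrow> {u, v} \<notin> edges G \<Longrightarrow>
       (\<phi> u = \<phi> v \<and> \<phi> u \<in> VW K) \<or> {\<phi> u, \<phi> v} \<in> EW K \<union> EG K"
    using assms(2) unfolding maps_to_def by blast
  have fW: "f u \<in> W" if "u \<in> verts F" for u
    using f that by (auto simp: bij_betw_def)
  then have fG: "f u \<in> verts G" if "u \<in> verts F" for u
    using W that by blast
  have inj: "f u \<noteq> f v" if "u \<in> verts F" "v \<in> verts F" "u \<noteq> v" for u v
    using f that by (auto simp: bij_betw_def inj_on_def)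
  have e': "{u, v} \<in> edges F \<longleftrightarrow> {f u, f v} \<in> edges G" if "u \<in> verts F" "v \<in> verts F" for u v
    using e[OF that] fW that by simp
  show ?thesis
    unfolding maps_to_def
  proof (intro exI[of _ "\<phi> \<circ> f"] conjI ballI impI)
    show "(\<phi> \<circ> f) ` verts F \<subseteq> crg_verts K"
      using \<phi>(1) fG by fastforce
  next
    fix u v assume "u \<in> verts F" "v \<in> verts F" "{u, v} \<in> edges F"
    then show "((\<phi> \<circ> f) u = (\<phi> \<circ> f) v \<and> (\<phi> \<circ> f) u \<in> VB K) \<or> {(\<phi> \<circ> f) u, (\<phi> \<circ> f) v} \<in> EB K \<union> EG K"
      using \<phi>(2)[of "f u" "f v"] fG e' by simp
  next
    fix u v assume "u \<in> verts F" "v \<in> verts F" "u \<noteq> v \<and> {u, v} \<notin> edges F"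
    then show "((\<phi> \<circ> f) u = (\<phi> \<circ> f) v \<and> (\<phi> \<circ> f) u \<in> VW K) \<or> {(\<phi> \<circ> f) u, (\<phi> \<circ> f) v} \<in> EW K \<union> EG K"
      using \<phi>(3)[of "f u" "f v"] fG inj e' by simp
  qed
qed

lemma admissible_crgs_Forb:
  assumes "\<forall>F\<in>\<F>. simple_graph F"
  shows "admissible_crgs (Forb \<F>) = {K. is_crg K \<and> \<not> family_maps_to \<F> K}"
proof -
  have "\<not> family_maps_to \<F> K"
    if eq: "Forb \<F> = Forb \<F>'" and no: "\<not> family_maps_to \<F>' K" for \<F>' K
  proof
    assume "family_maps_to \<F> K"
    then obtain F where F: "F \<in> \<F>" "maps_to F K"
      by (auto simp: family_maps_to_def)
    have "F \<notin> Forb \<F>"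
      using F(1) assms contains_induced_refl[of F] by (auto simp: Forb_def)
    then obtain F' where "F' \<in> \<F>'" "contains_induced F F'"
      using F(1) assms unfolding eq by (auto simp: Forb_def)
    then show False
      using F(2) no maps_to_contains_induced by (auto simp: family_maps_to_def)
  qed
  then show ?thesis
    using assms unfolding admissible_crgs_def by blast
qed

definition crg_matrix :: "crg \<Rightarrow> real \<Rightarrow> nat \<Rightarrow> nat \<Rightarrow> real" where
  "crg_matrix K p x y =
     (if (x = y \<and> x \<in> VW K) \<or> {x, y} \<in> EW K then p
      else if (x = y \<and> x \<in> VB K) \<or> {x, y} \<in> EB K then 1 - p
      else 0)"

definition prob_masses :: "crg \<Rightarrow> (nat \<Rightarrow> real) set" where
  "prob_masses K =
     {\<mu>. (\<forall>x. \<mu> x \<ge> 0) \<and> (\<forall>x. x \<notin> crg_verts K \<longrightarrow> \<mu> x = 0) \<and> (\<Sum>x\<in>crg_verts K. \<mu> x) = 1}"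

text \<open>The infimum is a minimum, since the simplex of probability masses is compact.\<close>

definition g_crg :: "crg \<Rightarrow> real \<Rightarrow> real" where
  "g_crg K p =
     (INF \<mu>\<in>prob_masses K.
        \<Sum>x\<in>crg_verts K. \<mu> x * (\<Sum>y\<in>crg_verts K. crg_matrix K p x y * \<mu> y))"

section \<open>Accumulation points\<close>

text \<open>A minimum over \<open>\<K>'\<close> only makes sense if \<open>\<K>'\<close> is non-empty.\<close>

definition regular_point :: "graph set \<Rightarrow> real \<Rightarrow> bool" where
  "regular_point \<H> p\<^sub>0 \<longleftrightarrow>
     hereditary \<H> \<and> nontrivial \<H> \<and> p\<^sub>0 \<in> {0..1} \<and>
     (\<exists>\<epsilon>>0. \<exists>\<K>'. finite \<K>' \<and> \<K>' \<noteq> {} \<and> \<K>' \<subseteq> admissible_crgs \<H> \<and>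
        (\<forall>p \<in> {p\<^sub>0 - \<epsilon><..<p\<^sub>0 + \<epsilon>} \<inter> {0..1}. ed \<H> p = Min ((\<lambda>K. g_crg K p) ` \<K>')))"

definition accumulation_point :: "graph set \<Rightarrow> real \<Rightarrow> bool" where
  "accumulation_point \<H> p\<^sub>0 \<longleftrightarrow>
     hereditary \<H> \<and> nontrivial \<H> \<and> p\<^sub>0 \<in> {0..1} \<and> \<not> regular_point \<H> p\<^sub>0"

end

theory Submission
  imports Defs "HOL-Real_Asymp.Real_Asymp"
begin

text \<open>
  The edit distance function of this property passes below \<open>p\<close> immediately to the right of
  \<open>1 / 4\<close>, but no single admissible CRG does so: each of them needs a little more room, and the
  room needed tends to 0 only along an infinite sequence of CRGs. Hence no finite set of CRGs can
  describe the function near \<open>1 / 4\<close>.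

  For the first claim, every admissible \<open>K\<close> and every probability mass \<open>\<mu>\<close> on it satisfy
  \<open>ed p \<le> \<langle>\<mu>, M\<^sub>K(p) \<mu>\<rangle>\<close> (\<open>ed_Forb_le_crg_form\<close>): place the vertices of a graph on \<open>K\<close> at random according
  to \<open>\<mu>\<close> and make the changes that \<open>K\<close> prescribes; the expected cost is the quadratic form, up to
  rounding, and the result maps to \<open>K\<close> and therefore contains no forbidden graph. The CRGs to use are
  paths of \<open>n\<close> black vertices with gray edges along the path and white edges elsewhere. They are
  admissible (\<open>gray_path_admissible\<close>), and uniform mass gives a value below \<open>p\<close> as soon as \<open>p > 1 / 4\<close>
  and \<open>n\<close> is large (\<open>gray_path_form_less\<close>).

  For the second claim, let \<open>K\<close> be admissible. Since the star with four leaves does not map to \<open>K\<close>, no gray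
  edge meets a white vertex, so entries of \<open>M\<^sub>K(p)\<close> below \<open>p\<close> occur only on gray edges between black vertices.
  Shifting mass (\<open>shift_mass\<close>) one may assume that there are no black edges between black vertices
  of the support. Then the star and the cycles force the gray graph on these vertices to be a union
  of paths (\<open>gray_form_gap\<close>). The adjacency matrix of such a graph has largest eigenvalue below 2
  (\<open>adjacency_form_gap\<close>), whereas a value of the form below \<open>p\<close> requires an eigenvalue above
  \<open>(1 - 2 * p) / p\<close>, which is 2 at \<open>p = 1 / 4\<close>. So \<open>g_crg K p \<ge> p\<close> on a right neighborhood of \<open>1 / 4\<close>
  that depends on \<open>K\<close> (\<open>eventually_crg_form_ge\<close>).
\<close>

section \<open>Hereditary properties\<close>

lemma hereditary_Forb: "hereditary (Forb \<F>)"
proof -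
  have iso: "contains_induced G F"
    if FH: "contains_induced H F" and GH: "graph_iso G H" for F G H
  proof -
    obtain W f where W: "W \<subseteq> verts H" and f: "bij_betw f (verts F) W"
      and fe: "\<And>u v. u \<in> verts F \<Longrightarrow> v \<in> verts F \<Longrightarrow>
        {u, v} \<in> edges F \<longleftrightarrow> {f u, f v} \<in> edges H \<and> {f u, f v} \<subseteq> W"
      using FH unfolding contains_induced_def graph_iso_def induced_subgraph_def by auto
    obtain g where g: "bij_betw g (verts G) (verts H)"
      and ge: "\<And>u v. u \<in> verts G \<Longrightarrow> v \<in> verts G \<Longrightarrow> {u, v} \<in> edges G \<longleftrightarrow> {g u, g v} \<in> edges H"
      using GH unfolding graph_iso_def by auto
    define h where "h = inv_into (verts G) g"
    have h: "bij_betw h (verts H) (verts G)"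
      unfolding h_def by (rule bij_betw_inv_into[OF g])
    have gh: "g (h x) = x" if "x \<in> verts H" for x
      unfolding h_def by (rule bij_betw_inv_into_right[OF g that])
    have fW: "f u \<in> W" if "u \<in> verts F" for u
      using f that by (auto simp: bij_betw_def)
    have hW: "h x \<in> h ` W" "h x \<in> verts G" if "x \<in> W" for x
      using h W that by (auto simp: bij_betw_def)
    have "bij_betw h W (h ` W)"
      using h W by (auto simp: bij_betw_def intro: inj_on_subset)
    then have "bij_betw (h \<circ> f) (verts F) (h ` W)"
      by (rule bij_betw_trans[OF f])
    moreover have "{u, v} \<in> edges F \<longleftrightarrow> {h (f u), h (f v)} \<in> edges G \<and> {h (f u), h (f v)} \<subseteq> h ` W"
      if "u \<in> verts F" "v \<in> verts F" for u v
    proof -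
      have "f u \<in> W" "f v \<in> W" using that fW by auto
      then show ?thesis
        using fe[OF that] ge[of "h (f u)" "h (f v)"] gh W hW by (auto simp: subset_iff)
    qed
    ultimately have "graph_iso F (induced_subgraph G (h ` W))"
      unfolding graph_iso_def induced_subgraph_def by (intro exI[of _ "h \<circ> f"]) simp
    moreover have "h ` W \<subseteq> verts G" using hW by auto
    ultimately show ?thesis
      unfolding contains_induced_def by blast
  qed
  have del: "contains_induced G F" 
    if con: "contains_induced (induced_subgraph G U) F" and U: "U \<subseteq> verts G" for G U F
  proof -
    have "verts (induced_subgraph G U) = U"
      by (simp add: induced_subgraph_def)
    then obtain W where W: "W \<subseteq> U" "graph_iso F (induced_subgraph (induced_subgraph G U) W)"
      using con unfolding contains_induced_def by auto
    moreover have "induced_subgraph (induced_subgraph G U) W = induced_subgraph G W"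
      using W(1) by (auto simp: induced_subgraph_def)
    ultimately show ?thesis
      using U unfolding contains_induced_def by auto
  qed
  have "simple_graph (induced_subgraph G U)" if "simple_graph G" "U \<subseteq> verts G" for G U
    using that by (auto simp: simple_graph_def induced_subgraph_def nsets_def finite_subset)
  then show ?thesis
    unfolding hereditary_def Forb_def using iso del by blast
qed

section \<open>Editing along a CRG\<close>

text \<open>
  Two vertices of a graph that are sent by \<open>\<phi>\<close> to \<open>a\<close> and \<open>b\<close> are governed by the edge \<open>{a, b}\<close> if
  \<open>a \<noteq> b\<close>, and by the color of the vertex \<open>a\<close> if \<open>a = b\<close>. Since then \<open>{a, b} = {a}\<close>, adding singletons
  to the edges treats both cases alike: the image \<open>\<phi> ` e\<close> decides what may happen to the pair \<open>e\<close>.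
\<close>

definition black_pairs :: "crg \<Rightarrow> nat set set" where
  "black_pairs K = EB K \<union> (\<lambda>x. {x}) ` VB K"

definition white_pairs :: "crg \<Rightarrow> nat set set" where
  "white_pairs K = EW K \<union> (\<lambda>x. {x}) ` VW K"

text \<open>
  This is \<open>\<langle>\<mu>, M\<^sub>K(p) \<mu>\<rangle>\<close>, the expression whose infimum over all probability masses is \<open>g_crg K p\<close>.
\<close>

definition crg_form :: "crg \<Rightarrow> real \<Rightarrow> (nat \<Rightarrow> real) \<Rightarrow> real" where
  "crg_form K p \<mu> = (\<Sum>x\<in>crg_verts K. \<mu> x * (\<Sum>y\<in>crg_verts K. crg_matrix K p x y * \<mu> y))"

lemma crg_edge_card:
  assumes "is_crg K" and "e \<in> EB K \<union> EW K \<union> EG K"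
  shows "e \<subseteq> crg_verts K" "card e = 2"
  using assms by (auto simp: is_crg_def nsets_def)

lemma pair_kinds:
  assumes K: "is_crg K" and "x \<in> crg_verts K" "y \<in> crg_verts K"
  shows "{x, y} \<in> black_pairs K \<union> white_pairs K \<union> EG K"
proof (cases "x = y")
  case True
  then show ?thesis
    using assms by (auto simp: black_pairs_def white_pairs_def crg_verts_def)
next
  case False
  then have "{x, y} \<in> nsets (crg_verts K) 2"
    using assms by simp
  then show ?thesis
    using K unfolding is_crg_def black_pairs_def white_pairs_def by blast
qed

lemma pair_kinds_disjoint:
  assumes K: "is_crg K"
  shows "black_pairs K \<inter> white_pairs K = {}" "black_pairs K \<inter> EG K = {}"
    "white_pairs K \<inter> EG K = {}"
proof -
  have "{x} \<notin> EB K \<union> EW K \<union> EG K" for x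
    using crg_edge_card(2)[OF K, of "{x}"] by auto
  then show "black_pairs K \<inter> white_pairs K = {}" "black_pairs K \<inter> EG K = {}"
    "white_pairs K \<inter> EG K = {}"
    using K unfolding is_crg_def black_pairs_def white_pairs_def by auto
qed

lemma crg_matrix_pairs:
  assumes "is_crg K"
  shows "crg_matrix K p x y =
    p * of_bool ({x, y} \<in> white_pairs K) + (1 - p) * of_bool ({x, y} \<in> black_pairs K)"
proof -
  have "{x, y} \<in> white_pairs K \<longleftrightarrow> (x = y \<and> x \<in> VW K) \<or> {x, y} \<in> EW K"
    "{x, y} \<in> black_pairs K \<longleftrightarrow> (x = y \<and> x \<in> VB K) \<or> {x, y} \<in> EB K"
    by (auto simp: white_pairs_def black_pairs_def)
  then show ?thesis
    using pair_kinds_disjoint(1)[OF assms] by (auto simp: crg_matrix_def)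
qed

lemma prob_masses_nonempty:
  assumes "is_crg K"
  shows "prob_masses K \<noteq> {}"
proof -
  obtain x where "x \<in> crg_verts K" "finite (crg_verts K)"
    using assms by (auto simp: is_crg_def)
  then have "(\<lambda>y. of_bool (y = x)) \<in> prob_masses K"
    by (auto simp: prob_masses_def of_bool_def)
  then show ?thesis by blast
qed

text \<open>
  The smallest change of \<open>G\<close> after which \<open>\<phi>\<close> witnesses that the result maps to \<open>K\<close>: pairs over
  black become edges, pairs over white become non-edges, and pairs over gray keep their status.
\<close>

definition edit_along :: "crg \<Rightarrow> (nat \<Rightarrow> nat) \<Rightarrow> graph \<Rightarrow> graph" where
  "edit_along K \<phi> G =
     \<lparr>verts = verts G,
      edges = {e \<in> nsets (verts G) 2. \<phi> ` e \<in> black_pairs K \<or> (\<phi> ` e \<in> EG K \<and> e \<in> edges G)}\<rparr>"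

lemma maps_to_edit_along:
  assumes K: "is_crg K" and \<phi>: "\<phi> ` verts G \<subseteq> crg_verts K"
  shows "maps_to (edit_along K \<phi> G) K"
  unfolding maps_to_def
proof (intro exI[of _ \<phi>] conjI ballI impI)
  show "\<phi> ` verts (edit_along K \<phi> G) \<subseteq> crg_verts K"
    using \<phi> by (simp add: edit_along_def)
next
  fix u v assume "{u, v} \<in> edges (edit_along K \<phi> G)"
  then show "(\<phi> u = \<phi> v \<and> \<phi> u \<in> VB K) \<or> {\<phi> u, \<phi> v} \<in> EB K \<union> EG K"
    by (auto simp: edit_along_def black_pairs_def)
next
  fix u v
  assume "u \<in> verts (edit_along K \<phi> G)" "v \<in> verts (edit_along K \<phi> G)"
    and "u \<noteq> v \<and> {u, v} \<notin> edges (edit_along K \<phi> G)"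
  moreover from this have "{\<phi> u, \<phi> v} \<in> black_pairs K \<union> white_pairs K \<union> EG K"
    using \<phi> by (intro pair_kinds[OF K]) (auto simp: edit_along_def)
  ultimately show "(\<phi> u = \<phi> v \<and> \<phi> u \<in> VW K) \<or> {\<phi> u, \<phi> v} \<in> EW K \<union> EG K"
    by (auto simp: edit_along_def white_pairs_def)
qed

text \<open>
  Mapping to \<open>K\<close> is inherited by induced subgraphs, so a graph that maps to \<open>K\<close> cannot contain a
  member of a family none of whose members maps to \<open>K\<close>.
\<close>

lemma in_Forb_if_maps_to:
  assumes "simple_graph G" and "maps_to G K" and "\<not> family_maps_to \<F> K"
  shows "G \<in> Forb \<F>"
  using assms maps_to_contains_induced by (auto simp: Forb_def family_maps_to_def)

lemma edit_along_in_Forb: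
  assumes "simple_graph G" and "is_crg K" and "\<not> family_maps_to \<F> K"
    and "\<phi> ` verts G \<subseteq> crg_verts K"
  shows "edit_along K \<phi> G \<in> Forb \<F>"
  using assms maps_to_edit_along
  by (intro in_Forb_if_maps_to) (auto simp: simple_graph_def edit_along_def)

lemma edit_dist_edit_along_le:
  assumes G: "simple_graph G" and K: "is_crg K" and \<phi>: "\<phi> ` verts G \<subseteq> crg_verts K"
  shows "edit_dist G (edit_along K \<phi> G) \<le>
    ((\<Sum>e\<in>edges G. of_bool (\<phi> ` e \<in> white_pairs K)) +
     (\<Sum>e\<in>nsets (verts G) 2 - edges G. of_bool (\<phi> ` e \<in> black_pairs K))) /
    real (card (verts G) choose 2)"
proof -
  let ?H = "edit_along K \<phi> G" and ?N = "nsets (verts G) 2"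
  have fin: "finite ?N" and sub: "edges G \<subseteq> ?N"
    using G by (auto simp: simple_graph_def finite_imp_finite_nsets)
  have finG: "finite (edges G)"
    using fin sub finite_subset by blast
  have "\<phi> ` e \<in> black_pairs K \<union> white_pairs K \<union> EG K" if "e \<in> ?N" for e
  proof -
    from that obtain u v where "e = {u, v}" "u \<in> verts G" "v \<in> verts G"
      by (auto elim: nsets2_E)
    then show ?thesis
      using pair_kinds[OF K, of "\<phi> u" "\<phi> v"] \<phi> by auto
  qed
  then have "(edges G - edges ?H) \<union> (edges ?H - edges G) \<subseteq>
      {e \<in> edges G. \<phi> ` e \<in> white_pairs K} \<union> {e \<in> ?N - edges G. \<phi> ` e \<in> black_pairs K}"
    using sub unfolding edit_along_def by auto
  then have "card ((edges G - edges ?H) \<union> (edges ?H - edges G)) \<le>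
      card ({e \<in> edges G. \<phi> ` e \<in> white_pairs K} \<union> {e \<in> ?N - edges G. \<phi> ` e \<in> black_pairs K})"
    using fin finG by (intro card_mono) auto
  also have "\<dots> \<le> card {e \<in> edges G. \<phi> ` e \<in> white_pairs K} +
      card {e \<in> ?N - edges G. \<phi> ` e \<in> black_pairs K}"
    by (rule card_Un_le)
  finally have "real (card ((edges G - edges ?H) \<union> (edges ?H - edges G))) \<le>
      real (card {e \<in> edges G. \<phi> ` e \<in> white_pairs K}) +
      real (card {e \<in> ?N - edges G. \<phi> ` e \<in> black_pairs K})"
    by linarith
  also have "\<dots> = (\<Sum>e\<in>edges G. of_bool (\<phi> ` e \<in> white_pairs K)) +
     (\<Sum>e\<in>?N - edges G. of_bool (\<phi> ` e \<in> black_pairs K))"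
    using fin finG by (simp add: of_bool_def sum.If_cases Int_def conj_commute)
  finally show ?thesis
    unfolding edit_dist_def by (intro divide_right_mono) auto
qed

text \<open>
  If every element of \<open>V\<close> chooses a value independently with distribution \<open>\<mu>\<close>, then the choices of
  \<open>u\<close> and \<open>v\<close> have joint distribution \<open>\<mu> \<times> \<mu>\<close>.
\<close>

lemma product_mass_expectation_pair:
  fixes \<mu> :: "'b \<Rightarrow> real"
  assumes V: "finite V" "u \<in> V" "v \<in> V" "u \<noteq> v" and U: "finite U" "sum \<mu> U = 1"
  shows "(\<Sum>\<phi>\<in>V \<rightarrow>\<^sub>E U. (\<Prod>w\<in>V. \<mu> (\<phi> w)) * f (\<phi> u) (\<phi> v)) =
    (\<Sum>a\<in>U. \<Sum>b\<in>U. \<mu> a * \<mu> b * f a b)"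
proof -
  have point: "(\<Sum>\<phi>\<in>V \<rightarrow>\<^sub>E U. (\<Prod>w\<in>V. \<mu> (\<phi> w)) * of_bool (\<phi> u = a \<and> \<phi> v = b)) = \<mu> a * \<mu> b"
    if ab: "a \<in> U" "b \<in> U" for a b
  proof -
    \<comment> \<open>The indicator of the prescribed values at u and v factors over the elements of V, so that
      the sum over all functions becomes a product of sums.\<close>
    let ?g = "\<lambda>w y. \<mu> y * of_bool ((w = u \<longrightarrow> y = a) \<and> (w = v \<longrightarrow> y = b))"
    have "(\<Prod>w\<in>V. ?g w (\<phi> w)) = (\<Prod>w\<in>V. \<mu> (\<phi> w)) * of_bool (\<phi> u = a \<and> \<phi> v = b)" for \<phi>
    proof (cases "\<phi> u = a \<and> \<phi> v = b")
      case True
      then show ?thesis by (auto intro!: prod.cong)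
    next
      case False
      then have "\<exists>w\<in>V. ?g w (\<phi> w) = 0"
        using V by auto
      then have "(\<Prod>w\<in>V. ?g w (\<phi> w)) = 0"
        using V by (simp only: prod_zero_iff)
      then show ?thesis using False by (auto simp del: prod_zero_iff)
    qed
    then have "(\<Sum>\<phi>\<in>V \<rightarrow>\<^sub>E U. (\<Prod>w\<in>V. \<mu> (\<phi> w)) * of_bool (\<phi> u = a \<and> \<phi> v = b)) =
        (\<Prod>w\<in>V. \<Sum>y\<in>U. ?g w y)"
      by (simp only: prod_sum_PiE[OF V(1) U(1)])
    also have "\<dots> = (\<Prod>w\<in>V. (if w = u then \<mu> a else 1) * (if w = v then \<mu> b else 1))"
    proof (rule prod.cong[OF refl])
      fix w
      have "(\<Sum>y\<in>U. \<mu> y * of_bool (y = c)) = \<mu> c" if "c \<in> U" for c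
        using U that by (simp add: of_bool_def if_distrib cong: if_cong)
      then show "(\<Sum>y\<in>U. ?g w y) = (if w = u then \<mu> a else 1) * (if w = v then \<mu> b else 1)"
        using ab U V by (cases "w = u"; cases "w = v") auto
    qed
    also have "\<dots> = \<mu> a * \<mu> b"
      using V by (simp add: prod.distrib)
    finally show ?thesis .
  qed
  have "(\<Sum>\<phi>\<in>V \<rightarrow>\<^sub>E U. (\<Prod>w\<in>V. \<mu> (\<phi> w)) * f (\<phi> u) (\<phi> v)) =
    (\<Sum>\<phi>\<in>V \<rightarrow>\<^sub>E U. \<Sum>a\<in>U. \<Sum>b\<in>U. (\<Prod>w\<in>V. \<mu> (\<phi> w)) * of_bool (\<phi> u = a \<and> \<phi> v = b) * f a b)"
  proof (rule sum.cong[OF refl])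
    fix \<phi> assume "\<phi> \<in> V \<rightarrow>\<^sub>E U"
    then have "\<phi> u \<in> U" "\<phi> v \<in> U" using V by auto
    moreover have "(\<Sum>b\<in>U. x * of_bool (\<phi> u = a \<and> \<phi> v = b) * f a b) =
        (if a = \<phi> u then x * f a (\<phi> v) else 0)" if "\<phi> v \<in> U" for a x
      using U that by (simp add: of_bool_def if_distrib if_distribR cong: if_cong)
    ultimately show "(\<Prod>w\<in>V. \<mu> (\<phi> w)) * f (\<phi> u) (\<phi> v) =
      (\<Sum>a\<in>U. \<Sum>b\<in>U. (\<Prod>w\<in>V. \<mu> (\<phi> w)) * of_bool (\<phi> u = a \<and> \<phi> v = b) * f a b)"
      using U by simp
  qed
  also have "\<dots> = (\<Sum>a\<in>U. \<Sum>b\<in>U.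
      (\<Sum>\<phi>\<in>V \<rightarrow>\<^sub>E U. (\<Prod>w\<in>V. \<mu> (\<phi> w)) * of_bool (\<phi> u = a \<and> \<phi> v = b)) * f a b)"
    by (subst sum.swap, rule sum.cong[OF refl], subst sum.swap) (simp add: sum_distrib_right)
  also have "\<dots> = (\<Sum>a\<in>U. \<Sum>b\<in>U. \<mu> a * \<mu> b * f a b)"
    by (intro sum.cong refl) (simp add: point)
  finally show ?thesis .
qed

text \<open>
  The probability that two independent vertices of \<open>K\<close> with distribution \<open>\<mu>\<close> form a pair in \<open>X\<close>.
\<close>

definition pair_mass :: "crg \<Rightarrow> (nat \<Rightarrow> real) \<Rightarrow> nat set set \<Rightarrow> real" where
  "pair_mass K \<mu> X =
     (\<Sum>a\<in>crg_verts K. \<Sum>b\<in>crg_verts K. \<mu> a * \<mu> b * of_bool ({a, b} \<in> X))"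

lemma crg_form_pair_mass:
  assumes "is_crg K"
  shows "crg_form K p \<mu> = p * pair_mass K \<mu> (white_pairs K) + (1 - p) * pair_mass K \<mu> (black_pairs K)"
  unfolding crg_form_def pair_mass_def crg_matrix_pairs[OF assms] sum_distrib_left sum.distrib[symmetric]
  by (intro sum.cong refl) (simp add: algebra_simps)

lemma pair_mass_bounds:
  assumes "\<mu> \<in> prob_masses K"
  shows "0 \<le> pair_mass K \<mu> X" "pair_mass K \<mu> X \<le> 1"
proof -
  have nn: "0 \<le> \<mu> x" for x
    using assms by (simp add: prob_masses_def)
  then show "0 \<le> pair_mass K \<mu> X"
    unfolding pair_mass_def by (intro sum_nonneg) simp
  have "pair_mass K \<mu> X \<le> (\<Sum>a\<in>crg_verts K. \<Sum>b\<in>crg_verts K. \<mu> a * \<mu> b)"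
    unfolding pair_mass_def using nn by (intro sum_mono) (auto simp: of_bool_def)
  also have "\<dots> = 1"
    using assms by (simp add: prob_masses_def flip: sum_distrib_left)
  finally show "pair_mass K \<mu> X \<le> 1" .
qed

text \<open>
  Choose \<open>\<phi>\<close> at random, independently for all vertices with distribution \<open>\<mu>\<close>. An edge of \<open>G\<close> is deleted
  with the probability of a white pair and a non-edge is added with the probability of a black pair,
  so the right-hand side is the expected distance, and some \<open>\<phi>\<close> does not exceed it.
\<close>

lemma edit_along_average:
  assumes G: "simple_graph G" and K: "is_crg K" and \<mu>: "\<mu> \<in> prob_masses K"
  shows "\<exists>\<phi>. \<phi> ` verts G \<subseteq> crg_verts K \<and>
    edit_dist G (edit_along K \<phi> G) \<le>
      (card (edges G) * pair_mass K \<mu> (white_pairs K) +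
       (real (card (verts G) choose 2) - card (edges G)) * pair_mass K \<mu> (black_pairs K)) /
      real (card (verts G) choose 2)"
proof -
  let ?V = "verts G" and ?U = "crg_verts K" and ?N = "nsets (verts G) 2"
  let ?C = "real (card (verts G) choose 2)"
  let ?w = "\<lambda>\<phi>. \<Prod>v\<in>?V. \<mu> (\<phi> v)"
  let ?B = "pair_mass K \<mu> (black_pairs K)" and ?W = "pair_mass K \<mu> (white_pairs K)"
  define cost :: "(nat \<Rightarrow> nat) \<Rightarrow> real" where
    "cost \<phi> = (\<Sum>e\<in>edges G. of_bool (\<phi> ` e \<in> white_pairs K)) +
      (\<Sum>e\<in>?N - edges G. of_bool (\<phi> ` e \<in> black_pairs K))" for \<phi>
  define avg where "avg = card (edges G) * ?W + (?C - card (edges G)) * ?B"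
  have finV: "finite ?V" and finU: "finite ?U" and sum1: "sum \<mu> ?U = 1" and nn: "0 \<le> \<mu> x" for x
    using G K \<mu> by (auto simp: simple_graph_def is_crg_def prob_masses_def)
  have sub: "edges G \<subseteq> ?N"
    using G by (simp add: simple_graph_def)
  have fin: "finite ?N"
    using finV by (rule finite_imp_finite_nsets)
  have cardN: "card (?N - edges G) = ?C - card (edges G)"
    using fin sub finV card_mono[OF fin sub] card_nsets[of ?V 2]
    by (simp add: card_Diff_subset finite_subset of_nat_diff)
  have weights: "(\<Sum>\<phi>\<in>?V \<rightarrow>\<^sub>E ?U. ?w \<phi>) = 1"
    using prod_sum_PiE[of ?V "\<lambda>_. ?U" "\<lambda>_. \<mu>"] finV finU sum1 by simp
  have pair: "(\<Sum>\<phi>\<in>?V \<rightarrow>\<^sub>E ?U. ?w \<phi> * of_bool (\<phi> ` e \<in> X)) = pair_mass K \<mu> X"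
    if "e \<in> ?N" for e X
  proof -
    from that obtain u v where e: "e = {u, v}" "u \<in> ?V" "v \<in> ?V" "u \<noteq> v"
      by (auto elim: nsets2_E)
    show ?thesis
      using product_mass_expectation_pair[OF finV e(2-4) finU sum1, of "\<lambda>a b. of_bool ({a, b} \<in> X)"]
      by (simp add: e(1) pair_mass_def)
  qed
  have "(\<Sum>\<phi>\<in>?V \<rightarrow>\<^sub>E ?U. ?w \<phi> * cost \<phi>) =
      (\<Sum>e\<in>edges G. \<Sum>\<phi>\<in>?V \<rightarrow>\<^sub>E ?U. ?w \<phi> * of_bool (\<phi> ` e \<in> white_pairs K)) +
      (\<Sum>e\<in>?N - edges G. \<Sum>\<phi>\<in>?V \<rightarrow>\<^sub>E ?U. ?w \<phi> * of_bool (\<phi> ` e \<in> black_pairs K))"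
    by (subst (1 2) sum.swap)
      (simp add: cost_def distrib_left sum.distrib flip: sum_distrib_left)
  also have "\<dots> = (\<Sum>e\<in>edges G. ?W) + (\<Sum>e\<in>?N - edges G. ?B)"
    using sub by (intro arg_cong2[where f = "(+)"] sum.cong refl pair) auto
  also have "\<dots> = avg"
    by (simp add: cardN avg_def)
  finally have avg: "(\<Sum>\<phi>\<in>?V \<rightarrow>\<^sub>E ?U. ?w \<phi> * (cost \<phi> - avg)) = 0"
    using weights by (simp add: right_diff_distrib sum_subtractf flip: sum_distrib_right)
  have "\<exists>\<phi>\<in>?V \<rightarrow>\<^sub>E ?U. cost \<phi> \<le> avg"
  proof (rule ccontr)
    assume "\<not> ?thesis"
    then have gt: "avg < cost \<phi>" if "\<phi> \<in> ?V \<rightarrow>\<^sub>E ?U" for \<phi>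
      using that by (meson not_le)
    have pos: "0 \<le> ?w \<phi> * (cost \<phi> - avg)" if "\<phi> \<in> ?V \<rightarrow>\<^sub>E ?U" for \<phi>
      using gt[OF that] nn by (intro mult_nonneg_nonneg prod_nonneg) auto
    have "finite (?V \<rightarrow>\<^sub>E ?U)"
      using finV finU by (intro finite_PiE) auto
    then have "\<forall>\<phi>\<in>?V \<rightarrow>\<^sub>E ?U. ?w \<phi> * (cost \<phi> - avg) = 0"
      using avg pos by (subst (asm) sum_nonneg_eq_0_iff) blast+
    then have "(\<Sum>\<phi>\<in>?V \<rightarrow>\<^sub>E ?U. ?w \<phi>) = 0"
      using gt by (intro sum.neutral) (metis diff_gt_0_iff_gt less_irrefl mult_eq_0_iff)
    then show False using weights by simp
  qed
  then obtain \<phi> where \<phi>: "\<phi> \<in> ?V \<rightarrow>\<^sub>E ?U" "cost \<phi> \<le> avg" by blast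
  then have im: "\<phi> ` ?V \<subseteq> ?U" by auto
  have "edit_dist G (edit_along K \<phi> G) \<le> cost \<phi> / ?C"
    unfolding cost_def by (rule edit_dist_edit_along_le[OF G K im])
  also have "\<dots> \<le> avg / ?C"
    using \<phi>(2) by (intro divide_right_mono) auto
  finally show ?thesis
    using im unfolding avg_def by blast
qed

lemma finite_Forb_on:
  assumes "finite V"
  shows "finite {H \<in> Forb \<F>. verts H = V}"
proof (rule finite_subset)
  show "{H \<in> Forb \<F>. verts H = V} \<subseteq> (\<lambda>E. \<lparr>verts = V, edges = E\<rparr>) ` Pow (nsets V 2)"
    by (auto simp: Forb_def simple_graph_def image_iff intro!: graph.equality)
  show "finite ((\<lambda>E. \<lparr>verts = V, edges = E\<rparr>) ` Pow (nsets V 2))"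
    using assms by (simp add: finite_imp_finite_nsets)
qed

lemma edit_dist_to_Forb_le:
  assumes G: "simple_graph G" and H: "H \<in> Forb \<F>" "verts H = verts G"
  shows "edit_dist_to G (Forb \<F>) \<le> edit_dist G H"
proof -
  have "finite {H \<in> Forb \<F>. verts H = verts G}"
    using G by (intro finite_Forb_on) (simp add: simple_graph_def)
  then show ?thesis
    unfolding edit_dist_to_def using H by (intro Min_le) auto
qed

text \<open>
  The maximum in \<open>max_edit_dist\<close> is taken over infinitely many graphs; it is meaningful because only
  finitely many values occur.
\<close>

lemma edit_dist_to_Forb_values:
  assumes G: "simple_graph G" and H: "H \<in> Forb \<F>" "verts H = verts G"
  shows "edit_dist_to G (Forb \<F>) \<in>
    (\<lambda>k. real k / real (card (verts G) choose 2)) ` {..card (verts G) choose 2}"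
proof -
  have fin: "finite {H \<in> Forb \<F>. verts H = verts G}"
    using G by (intro finite_Forb_on) (simp add: simple_graph_def)
  then have "edit_dist_to G (Forb \<F>) \<in> edit_dist G ` {H \<in> Forb \<F>. verts H = verts G}"
    unfolding edit_dist_to_def using H by (intro Min_in) auto
  then obtain H' where H': "H' \<in> Forb \<F>" "verts H' = verts G"
    and eq: "edit_dist_to G (Forb \<F>) = edit_dist G H'" by auto
  have "(edges G - edges H') \<union> (edges H' - edges G) \<subseteq> nsets (verts G) 2"
    using G H' by (auto simp: Forb_def simple_graph_def)
  then have "card ((edges G - edges H') \<union> (edges H' - edges G)) \<le> card (nsets (verts G) 2)"
    using G by (intro card_mono) (auto simp: simple_graph_def finite_imp_finite_nsets)
  then show ?thesis
    using G unfolding eq edit_dist_def by (auto simp: simple_graph_def card_nsets)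
qed

lemma graph_with_edge_number:
  assumes "k \<le> n choose 2"
  shows "\<exists>G. simple_graph G \<and> card (verts G) = n \<and> card (edges G) = k"
proof -
  have "k \<le> card (nsets {..<n} 2)"
    using assms by (simp add: card_nsets)
  then obtain E where "E \<subseteq> nsets {..<n} 2" "card E = k"
    by (meson obtain_subset_with_card_n)
  then show ?thesis
    by (intro exI[of _ "\<lparr>verts = {..<n}, edges = E\<rparr>"]) (simp add: simple_graph_def)
qed

text \<open>
  The error term comes from rounding the number of edges: it is \<open>p * (n choose 2)\<close> up to less
  than one.
\<close>

lemma max_edit_dist_le:
  assumes K: "is_crg K" "\<not> family_maps_to \<F> K" and \<mu>: "\<mu> \<in> prob_masses K"
    and p: "0 \<le> p" "p \<le> 1" and n: "2 \<le> n"
  shows "max_edit_dist (Forb \<F>) p n \<le> crg_form K p \<mu> + 1 / real (n choose 2)"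
proof -
  let ?C = "real (n choose 2)"
  let ?\<G> = "{G. simple_graph G \<and> card (verts G) = n \<and> int (card (edges G)) = \<lfloor>p * ?C\<rfloor>}"
  let ?B = "pair_mass K \<mu> (black_pairs K)" and ?W = "pair_mass K \<mu> (white_pairs K)"
  have C: "0 < ?C" using n by simp
  have "\<lfloor>p * ?C\<rfloor> \<le> int (n choose 2)"
    using p C by (simp add: floor_le_iff mult_left_le_one_le add.commute less_add_one
        order.strict_trans1[of _ ?C])
  moreover have "0 \<le> \<lfloor>p * ?C\<rfloor>"
    using p by simp
  ultimately obtain G0 where "G0 \<in> ?\<G>"
    using graph_with_edge_number[of "nat \<lfloor>p * ?C\<rfloor>" n] by (force simp: nat_le_iff)
  then have ne: "?\<G> \<noteq> {}" by blast
  have ex: "\<exists>H\<in>Forb \<F>. verts H = verts G \<and> edit_dist G H \<le> crg_form K p \<mu> + 1 / ?C"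
    if "G \<in> ?\<G>" for G
  proof -
    from that have G: "simple_graph G" and card: "card (verts G) = n"
      and e: "int (card (edges G)) = \<lfloor>p * ?C\<rfloor>" by auto
    obtain \<phi> where \<phi>: "\<phi> ` verts G \<subseteq> crg_verts K" and dist: "edit_dist G (edit_along K \<phi> G) \<le>
      (card (edges G) * ?W + (?C - card (edges G)) * ?B) / ?C"
      using edit_along_average[OF G K(1) \<mu>] card by auto
    have "real (card (edges G)) = of_int \<lfloor>p * ?C\<rfloor>"
      using e by (metis of_int_of_nat_eq)
    then have "card (edges G) \<le> p * ?C" "p * ?C - 1 \<le> card (edges G)"
      by linarith+
    then have "card (edges G) * ?W \<le> p * ?C * ?W"
      and "(?C - card (edges G)) * ?B \<le> (?C - p * ?C + 1) * ?B"
      using pair_mass_bounds(1)[OF \<mu>] by (intro mult_right_mono; simp)+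
    moreover have "(?C - p * ?C + 1) * ?B \<le> (?C - p * ?C) * ?B + 1"
      using pair_mass_bounds(2)[OF \<mu>] by (simp add: algebra_simps)
    ultimately have "card (edges G) * ?W + (?C - card (edges G)) * ?B \<le> ?C * crg_form K p \<mu> + 1"
      unfolding crg_form_pair_mass[OF K(1)] by (simp add: algebra_simps)
    then have "(card (edges G) * ?W + (?C - card (edges G)) * ?B) / ?C \<le>
        (?C * crg_form K p \<mu> + 1) / ?C"
      using C by (intro divide_right_mono) auto
    also have "\<dots> = crg_form K p \<mu> + 1 / ?C"
      using C by (simp only: add_divide_distrib) simp
    finally have "(card (edges G) * ?W + (?C - card (edges G)) * ?B) / ?C \<le> crg_form K p \<mu> + 1 / ?C" .
    with dist show ?thesis
      using edit_along_in_Forb[OF G K \<phi>]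
      by (intro bexI[of _ "edit_along K \<phi> G"]) (auto simp: edit_along_def)
  qed
  have "(\<lambda>G. edit_dist_to G (Forb \<F>)) ` ?\<G> \<subseteq> (\<lambda>k. real k / ?C) ` {..n choose 2}"
    using ex edit_dist_to_Forb_values by fastforce
  then have "finite ((\<lambda>G. edit_dist_to G (Forb \<F>)) ` ?\<G>)"
    by (rule finite_subset) simp
  then show ?thesis
    unfolding max_edit_dist_def
  proof (rule Max.boundedI)
    show "(\<lambda>G. edit_dist_to G (Forb \<F>)) ` ?\<G> \<noteq> {}"
      using ne by blast
    show "a \<le> crg_form K p \<mu> + 1 / ?C" if "a \<in> (\<lambda>G. edit_dist_to G (Forb \<F>)) ` ?\<G>" for a
      using that ex edit_dist_to_Forb_le order_trans by blast
  qed
qed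

lemma ed_Forb_le_crg_form:
  assumes K: "is_crg K" "\<not> family_maps_to \<F> K" and \<mu>: "\<mu> \<in> prob_masses K"
    and p: "0 \<le> p" "p \<le> 1"
  shows "ed (Forb \<F>) p \<le> crg_form K p \<mu>"
proof -
  have "filterlim (\<lambda>n. real (n choose 2)) at_top sequentially"
  proof (rule filterlim_at_top_mono)
    show "filterlim (\<lambda>n. real n - 1) at_top sequentially" by real_asymp
    show "\<forall>\<^sub>F n in sequentially. real n - 1 \<le> real (n choose 2)"
      using eventually_ge_at_top[of 2]
    proof eventually_elim
      case (elim n)
      then have "2 * (real n - 1) \<le> real n * (real n - 1)"
        by (intro mult_right_mono) auto
      then show ?case
        using elim by (simp add: choose_two real_of_nat_div of_nat_diff)
    qed
  qed
  then have "(\<lambda>n. crg_form K p \<mu> + 1 / real (n choose 2)) \<longlonglongrightarrow> crg_form K p \<mu> + 0"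
    by (intro tendsto_add tendsto_const real_tendsto_divide_at_top[OF tendsto_const])
  then have "limsup (\<lambda>n. ereal (crg_form K p \<mu> + 1 / real (n choose 2))) = ereal (crg_form K p \<mu>)"
    by (intro lim_imp_Limsup) auto
  moreover have "limsup (\<lambda>n. ereal (max_edit_dist (Forb \<F>) p n)) \<le>
      limsup (\<lambda>n. ereal (crg_form K p \<mu> + 1 / real (n choose 2)))"
    by (intro Limsup_mono eventually_mono[OF eventually_ge_at_top[of 2]])
      (use max_edit_dist_le[OF K \<mu> p] in simp)
  moreover have "0 \<le> crg_form K p \<mu>"
    using p pair_mass_bounds[OF \<mu>] unfolding crg_form_pair_mass[OF K(1)] by simp
  ultimately show ?thesis
    unfolding ed_def by (cases "limsup (\<lambda>n. ereal (max_edit_dist (Forb \<F>) p n))") auto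
qed

section \<open>Shifting mass\<close>

text \<open>
  A minimizer of a quadratic form on the simplex with smallest support satisfies the last condition.
  As long as two points \<open>x\<close> and \<open>y\<close> of the support violate it, the form
  is concave in the direction that moves mass from \<open>y\<close> to \<open>x\<close>, and one of the two orientations
  starts with a non-positive slope. Moving all the mass of one point therefore does not increase
  the form, and the support shrinks.
\<close>

lemma shift_mass:
  fixes M :: "'a \<Rightarrow> 'a \<Rightarrow> real" and \<mu> :: "'a \<Rightarrow> real"
  assumes V: "finite V" and sym: "\<And>x y. x \<in> V \<Longrightarrow> y \<in> V \<Longrightarrow> M x y = M y x"
    and "\<And>x. 0 \<le> \<mu> x"
  shows "\<exists>\<nu>. (\<forall>x. 0 \<le> \<nu> x) \<and> (\<forall>x. \<nu> x \<noteq> 0 \<longrightarrow> \<mu> x \<noteq> 0) \<and> sum \<nu> V = sum \<mu> V \<and>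
    (\<Sum>x\<in>V. \<nu> x * (\<Sum>y\<in>V. M x y * \<nu> y)) \<le> (\<Sum>x\<in>V. \<mu> x * (\<Sum>y\<in>V. M x y * \<mu> y)) \<and>
    (\<forall>x\<in>V. \<forall>y\<in>V. x \<noteq> y \<and> \<nu> x \<noteq> 0 \<and> \<nu> y \<noteq> 0 \<longrightarrow> 2 * M x y < M x x + M y y)"
  using assms(3)
proof (induction "card {x \<in> V. \<mu> x \<noteq> 0}" arbitrary: \<mu> rule: less_induct)
  case (less \<mu>)
  let ?r = "\<lambda>x. \<Sum>y\<in>V. M x y * \<mu> y"
  show ?case
  proof (cases "\<forall>x\<in>V. \<forall>y\<in>V. x \<noteq> y \<and> \<mu> x \<noteq> 0 \<and> \<mu> y \<noteq> 0 \<longrightarrow> 2 * M x y < M x x + M y y")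
    case True
    then show ?thesis
      using less.prems by (intro exI[of _ \<mu>]) auto
  next
    case False
    then obtain a b where ab: "a \<in> V" "b \<in> V" "a \<noteq> b" "\<mu> a \<noteq> 0" "\<mu> b \<noteq> 0"
      "M a a + M b b \<le> 2 * M a b"
      by force
    have "\<exists>x y. x \<in> V \<and> y \<in> V \<and> x \<noteq> y \<and> \<mu> x \<noteq> 0 \<and> \<mu> y \<noteq> 0 \<and>
        M x x + M y y \<le> 2 * M x y \<and> ?r x \<le> ?r y"
    proof (cases "?r a \<le> ?r b")
      case True
      with ab show ?thesis by blast
    next
      case False
      with ab sym[of a b] show ?thesis
        by (intro exI[of _ b] exI[of _ a]) auto
    qed
    then obtain x y where xy: "x \<in> V" "y \<in> V" "x \<noteq> y" "\<mu> x \<noteq> 0" "\<mu> y \<noteq> 0"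
      "M x x + M y y \<le> 2 * M x y" "?r x \<le> ?r y"
      by blast
    define t where "t = \<mu> y"
    define \<eta> :: "'a \<Rightarrow> real" where "\<eta> z = of_bool (z = x) - of_bool (z = y)" for z
    define \<mu>' where "\<mu>' z = \<mu> z + t * \<eta> z" for z
    have t: "0 \<le> t" using less.prems by (simp add: t_def)
    have \<eta>: "(\<Sum>z\<in>V. f z * \<eta> z) = f x - f y" for f
    proof -
      have "(\<Sum>z\<in>V. f z * of_bool (z = c)) = f c" if "c \<in> V" for c
        using V that by (simp add: of_bool_def if_distrib cong: if_cong)
      then show ?thesis
        using xy by (simp add: \<eta>_def right_diff_distrib sum_subtractf)
    qed
    have row: "(\<Sum>z\<in>V. M w z * \<mu>' z) = ?r w + t * (M w x - M w y)" for w
      using \<eta>[of "M w"] by (simp add: \<mu>'_def distrib_left sum.distrib mult.left_commute[of _ t]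
          flip: sum_distrib_left)
    have col: "(\<Sum>w\<in>V. \<mu> w * M w z) = ?r z" if "z \<in> V" for z
      using sym that by (intro sum.cong refl) (simp add: mult.commute)
    have "(\<Sum>w\<in>V. \<mu>' w * (\<Sum>z\<in>V. M w z * \<mu>' z)) =
      (\<Sum>w\<in>V. \<mu> w * ?r w + t * (\<mu> w * M w x - \<mu> w * M w y) + t * (?r w * \<eta> w) +
         t\<^sup>2 * ((M w x - M w y) * \<eta> w))"
      unfolding row by (intro sum.cong refl) (simp add: \<mu>'_def algebra_simps power2_eq_square)
    also have "\<dots> = (\<Sum>w\<in>V. \<mu> w * ?r w) + 2 * t * (?r x - ?r y) + t\<^sup>2 * (M x x + M y y - 2 * M x y)"
      using col[OF xy(1)] col[OF xy(2)] sym[OF xy(1,2)]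
      unfolding sum.distrib sum_distrib_left[symmetric] \<eta> sum_subtractf
      by (simp add: algebra_simps)
    also have "\<dots> \<le> (\<Sum>w\<in>V. \<mu> w * ?r w)"
      using t xy(6,7) mult_nonneg_nonpos[of "2 * t" "?r x - ?r y"]
        mult_nonneg_nonpos[of "t\<^sup>2" "M x x + M y y - 2 * M x y"] by simp
    finally have form: "(\<Sum>w\<in>V. \<mu>' w * (\<Sum>z\<in>V. M w z * \<mu>' z)) \<le> (\<Sum>w\<in>V. \<mu> w * ?r w)" .
    have sum: "sum \<mu>' V = sum \<mu> V"
      using \<eta>[of "\<lambda>_. 1"] by (simp add: \<mu>'_def sum.distrib flip: sum_distrib_left)
    have supp: "\<mu> z \<noteq> 0" if "\<mu>' z \<noteq> 0" for z
      using that xy by (auto simp: \<mu>'_def \<eta>_def of_bool_def split: if_splits)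
    have "\<mu>' y = 0"
      using xy by (simp add: \<mu>'_def \<eta>_def t_def)
    then have "{z \<in> V. \<mu>' z \<noteq> 0} \<subset> {z \<in> V. \<mu> z \<noteq> 0}"
      using supp xy by blast
    then have "card {z \<in> V. \<mu>' z \<noteq> 0} < card {z \<in> V. \<mu> z \<noteq> 0}"
      using V by (intro psubset_card_mono) auto
    moreover have "0 \<le> \<mu>' z" for z
      using less.prems[of z] t xy by (auto simp: \<mu>'_def \<eta>_def t_def of_bool_def)
    ultimately obtain \<nu> where \<nu>: "\<forall>x. 0 \<le> \<nu> x" "\<forall>x. \<nu> x \<noteq> 0 \<longrightarrow> \<mu>' x \<noteq> 0" "sum \<nu> V = sum \<mu>' V"
      "(\<Sum>x\<in>V. \<nu> x * (\<Sum>y\<in>V. M x y * \<nu> y)) \<le> (\<Sum>x\<in>V. \<mu>' x * (\<Sum>y\<in>V. M x y * \<mu>' y))"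
      "\<forall>x\<in>V. \<forall>y\<in>V. x \<noteq> y \<and> \<nu> x \<noteq> 0 \<and> \<nu> y \<noteq> 0 \<longrightarrow> 2 * M x y < M x x + M y y"
      using less.hyps[of \<mu>'] by blast
    then show ?thesis
      using form sum supp by (intro exI[of _ \<nu>]) auto
  qed
qed

section \<open>Path-like graphs have spectral radius below two\<close>

text \<open>
  A walk that never turns back directly can be continued forever, so it returns to an earlier vertex.
  A shortest closed stretch of it is a cycle; its length is not 1 because there are no loops and
  not 2 because the walk does not turn back.
\<close>

lemma cycle_if_min_degree_two:
  assumes T: "finite T" "T \<noteq> {}"
    and deg: "\<And>x. x \<in> T \<Longrightarrow> \<exists>y\<in>T. \<exists>z\<in>T. y \<noteq> z \<and> R x y \<and> R x z"
    and irrefl: "\<And>x. \<not> R x x"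
  shows "\<exists>k\<ge>3. \<exists>c. inj_on c {..<k} \<and> c ` {..<k} \<subseteq> T \<and> (\<forall>i<k. R (c i) (c (Suc i mod k)))"
proof -
  have step: "\<exists>b'\<in>T. R b b' \<and> b' \<noteq> a" if "b \<in> T" for a b
    using deg[OF that] by metis
  let ?P = "\<lambda>ab. fst ab \<in> T \<and> snd ab \<in> T \<and> R (fst ab) (snd ab)"
  have "\<exists>f. \<forall>n. ?P (f n) \<and> (fst (f (Suc n)) = snd (f n) \<and> snd (f (Suc n)) \<noteq> fst (f n))"
  proof (rule dependent_nat_choice)
    obtain x0 where "x0 \<in> T" using T by blast
    then obtain y0 where "y0 \<in> T" "R x0 y0" using deg by blast
    then show "\<exists>ab. ?P ab"
      using \<open>x0 \<in> T\<close> by (intro exI[of _ "(x0, y0)"]) simp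
    fix ab :: "'a \<times> 'a" assume "?P ab"
    moreover from this obtain b' where "b' \<in> T" "R (snd ab) b'" "b' \<noteq> fst ab"
      using step by blast
    ultimately show "\<exists>ab'. ?P ab' \<and> fst ab' = snd ab \<and> snd ab' \<noteq> fst ab"
      by (intro exI[of _ "(snd ab, b')"]) simp
  qed
  then obtain f where f: "\<And>n. ?P (f n)"
    "\<And>n. fst (f (Suc n)) = snd (f n)" "\<And>n. snd (f (Suc n)) \<noteq> fst (f n)"
    by metis
  define w where "w n = fst (f n)" for n
  have wT: "w n \<in> T" and wR: "R (w n) (w (Suc n))" and nb: "w (Suc (Suc n)) \<noteq> w n" for n
    using f(1)[of n] f(2)[of n] f(2)[of "Suc n"] f(3)[of n] by (simp_all add: w_def)
  have "\<not> inj w"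
    using wT T(1) by (meson finite_subset image_subsetI infinite_UNIV_nat inj_on_finite)
  then obtain i j where "w i = w j" "i < j"
    by (metis injI linorder_neqE_nat)
  then have ex: "\<exists>d. 0 < d \<and> (\<exists>i. w i = w (i + d))"
    by (intro exI[of _ "j - i"] conjI exI[of _ i]) auto
  define k where "k = (LEAST d. 0 < d \<and> (\<exists>i. w i = w (i + d)))"
  have k: "0 < k" "\<exists>i. w i = w (i + k)"
    unfolding k_def using LeastI_ex[OF ex] by auto
  have min: "w i \<noteq> w (i + d)" if "0 < d" "d < k" for i d
    using that not_less_Least[of d] unfolding k_def by blast
  obtain i where i: "w i = w (i + k)" using k by blast
  have "k \<noteq> 1" "k \<noteq> 2"
    using i wR[of i] irrefl nb[of i] by auto
  then have "3 \<le> k" using k by linarith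
  moreover have "inj_on (\<lambda>m. w (i + m)) {..<k}"
  proof (rule linorder_inj_onI')
    fix m m' assume "m \<in> {..<k}" "m' \<in> {..<k}" "m < m'"
    then show "w (i + m) \<noteq> w (i + m')"
      using min[of "m' - m" "i + m"] by auto
  qed
  moreover have "R (w (i + m)) (w (i + Suc m mod k))" if "m < k" for m
  proof (cases "Suc m = k")
    case True
    then show ?thesis using wR[of "i + m"] i by (metis add_Suc_right add_0_right mod_self)
  next
    case False
    then show ?thesis using wR[of "i + m"] that by simp
  qed
  ultimately show ?thesis
    using wT by (intro exI[of _ k] conjI exI[of _ "\<lambda>m. w (i + m)"]) auto
qed

text \<open>
  The form on the left is that of the adjacency matrix of \<open>R\<close> on \<open>S\<close>, so this says that its largest
  eigenvalue is below 2. With \<open>d x\<close> the degree of \<open>x\<close>, and the first sum over ordered pairs,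
  \<open>(\<Sum>R x y. (\<nu> x - \<nu> y)\<^sup>2) + 2 * (\<Sum>x. (2 - d x) * (\<nu> x)\<^sup>2) = 4 * (\<Sum>x. (\<nu> x)\<^sup>2) - 2 * (\<Sum>R x y. \<nu> x * \<nu> y)\<close>.
  Both sums on the left are non-negative. If both vanish, then \<open>\<nu>\<close> is constant along edges and its
  support consists of vertices of degree 2 and is closed under neighbors, which the last
  assumption excludes unless \<open>\<nu>\<close> is zero. Hence the form is below 2 everywhere on the unit sphere,
  and compactness of the sphere gives the constant \<open>c\<close>.
\<close>

lemma adjacency_form_gap:
  fixes R :: "'a \<Rightarrow> 'a \<Rightarrow> bool"
  assumes S: "finite S" and sym: "\<And>x y. R x y \<Longrightarrow> R y x"
    and deg: "\<And>x. x \<in> S \<Longrightarrow> card {y \<in> S. R x y} \<le> 2"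
    and no2: "\<And>T. T \<subseteq> S \<Longrightarrow> T \<noteq> {} \<Longrightarrow>
      \<exists>x\<in>T. card {y \<in> S. R x y} \<noteq> 2 \<or> \<not> {y \<in> S. R x y} \<subseteq> T"
  shows "\<exists>c>0. \<forall>\<nu>::'a \<Rightarrow> real.
    (\<Sum>x\<in>S. \<Sum>y | y \<in> S \<and> R x y. \<nu> x * \<nu> y) \<le> (2 - c) * (\<Sum>x\<in>S. (\<nu> x)\<^sup>2)"
proof (cases "S = {}")
  case True
  then show ?thesis by (auto intro: exI[of _ 1])
next
  case False
  define f :: "('a \<Rightarrow> real) \<Rightarrow> real" where "f \<nu> = (\<Sum>x\<in>S. \<Sum>y | y \<in> S \<and> R x y. \<nu> x * \<nu> y)" for \<nu>
  define q :: "('a \<Rightarrow> real) \<Rightarrow> real" where "q \<nu> = (\<Sum>x\<in>S. (\<nu> x)\<^sup>2)" for \<nu>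
  have less2: "f \<nu> < 2" if q1: "q \<nu> = 1" for \<nu>
  proof (rule ccontr)
    assume "\<not> f \<nu> < 2"
    let ?d = "\<lambda>x. card {y \<in> S. R x y}"
    let ?D = "\<Sum>x\<in>S. \<Sum>y | y \<in> S \<and> R x y. (\<nu> x - \<nu> y)\<^sup>2"
    let ?L = "\<Sum>x\<in>S. (2 - real (?d x)) * (\<nu> x)\<^sup>2"
    have "(\<Sum>x\<in>S. \<Sum>y | y \<in> S \<and> R x y. (\<nu> y)\<^sup>2) = (\<Sum>y\<in>S. \<Sum>x | x \<in> S \<and> R x y. (\<nu> y)\<^sup>2)"
      by (rule sum.swap_restrict[OF S S])
    also have "\<dots> = (\<Sum>y\<in>S. real (?d y) * (\<nu> y)\<^sup>2)"
    proof (intro sum.cong refl)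
      fix y
      have "{x \<in> S. R x y} = {x \<in> S. R y x}" using sym by blast
      then show "(\<Sum>x | x \<in> S \<and> R x y. (\<nu> y)\<^sup>2) = real (?d y) * (\<nu> y)\<^sup>2" by simp
    qed
    finally have "?D = 2 * (\<Sum>x\<in>S. real (?d x) * (\<nu> x)\<^sup>2) - 2 * f \<nu>"
      by (simp add: power2_diff sum.distrib sum_subtractf f_def sum_distrib_left mult.assoc)
    moreover have "?L = 2 * q \<nu> - (\<Sum>x\<in>S. real (?d x) * (\<nu> x)\<^sup>2)"
      by (simp add: left_diff_distrib sum_subtractf q_def sum_distrib_left)
    ultimately have "?D + 2 * ?L \<le> 0"
      using \<open>\<not> f \<nu> < 2\<close> q1 by simp
    moreover have "0 \<le> ?D" by (intro sum_nonneg) auto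
    moreover have Lnn: "0 \<le> (2 - real (?d x)) * (\<nu> x)\<^sup>2" if "x \<in> S" for x
      using deg[OF that] by (intro mult_nonneg_nonneg) auto
    then have "0 \<le> ?L" by (intro sum_nonneg)
    ultimately have D0: "?D = 0" and L0: "?L = 0" by linarith+
    have same: "\<nu> y = \<nu> x" if "x \<in> S" "y \<in> S" "R x y" for x y
    proof -
      have "(\<Sum>y | y \<in> S \<and> R x y. (\<nu> x - \<nu> y)\<^sup>2) = 0"
        using D0 that(1) S by (subst (asm) sum_nonneg_eq_0_iff) (auto intro: sum_nonneg)
      then have "(\<nu> x - \<nu> y)\<^sup>2 = 0"
        using that S by (subst (asm) sum_nonneg_eq_0_iff) auto
      then show ?thesis by simp
    qed
    have two: "?d x = 2" if "x \<in> S" "\<nu> x \<noteq> 0" for x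
    proof -
      have "(2 - real (?d x)) * (\<nu> x)\<^sup>2 = 0"
        using L0 S that(1) Lnn by (subst (asm) sum_nonneg_eq_0_iff) auto
      then show ?thesis using that by simp
    qed
    have "{x \<in> S. \<nu> x \<noteq> 0} \<noteq> {}"
      using q1 unfolding q_def by (metis (mono_tags, lifting) empty_iff mem_Collect_eq
          power_zero_numeral sum.neutral zero_neq_one)
    then obtain x where "x \<in> S" "\<nu> x \<noteq> 0"
      "?d x \<noteq> 2 \<or> \<not> {y \<in> S. R x y} \<subseteq> {x \<in> S. \<nu> x \<noteq> 0}"
      using no2[of "{x \<in> S. \<nu> x \<noteq> 0}"] by blast
    then show False
      using two same by auto
  qed
  \<comment> \<open>The unit sphere, with coordinates outside S set to 0 so that it is compact in the product
    topology on all functions.\<close>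
  define C where "C = {\<nu>. (\<forall>x\<in>S. \<nu> x \<in> {-1..1}) \<and> (\<forall>x. x \<notin> S \<longrightarrow> \<nu> x = 0) \<and> q \<nu> = 1}"
  have "compact (PiE UNIV (\<lambda>x. if x \<in> S then {-1..1::real} else {0}))"
    using compactin_PiE[of "\<lambda>_. euclidean" UNIV "\<lambda>x. if x \<in> S then {-1..1::real} else {0}"]
    by (simp add: euclidean_product_topology)
  moreover have "closed {\<nu>. q \<nu> = 1}"
    unfolding q_def by (intro closed_Collect_eq continuous_intros continuous_on_product_coordinates)
  moreover have "C = PiE UNIV (\<lambda>x. if x \<in> S then {-1..1::real} else {0}) \<inter> {\<nu>. q \<nu> = 1}"
    unfolding C_def PiE_UNIV_domain by (auto simp: Pi_iff split: if_splits)
  ultimately have "compact C"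
    by (simp add: compact_Int_closed)
  moreover have "C \<noteq> {}"
  proof -
    obtain s where "s \<in> S" using False by blast
    then have "(\<lambda>x. of_bool (x = s)) \<in> C"
      using S by (auto simp: C_def q_def of_bool_def power2_eq_square if_distrib cong: if_cong)
    then show ?thesis by blast
  qed
  moreover have "continuous_on C f"
    unfolding f_def
    by (intro continuous_intros continuous_on_subset[OF continuous_on_product_coordinates subset_UNIV])
  ultimately obtain \<nu>0 where \<nu>0: "\<nu>0 \<in> C" "\<And>\<nu>. \<nu> \<in> C \<Longrightarrow> f \<nu> \<le> f \<nu>0"
    using continuous_attains_sup[of C f] by auto
  have bound: "f \<nu> \<le> f \<nu>0 * q \<nu>" for \<nu>
  proof (cases "q \<nu> = 0")
    case True
    then have "\<forall>x\<in>S. \<nu> x = 0"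
      unfolding q_def using S by (subst (asm) sum_nonneg_eq_0_iff) auto
    then show ?thesis by (simp add: f_def True)
  next
    case False
    have "0 \<le> q \<nu>" unfolding q_def by (intro sum_nonneg) auto
    with False have pos: "0 < q \<nu>" by simp
    define \<nu>' where "\<nu>' x = (if x \<in> S then \<nu> x / sqrt (q \<nu>) else 0)" for x
    have sq: "sqrt (q \<nu>) * sqrt (q \<nu>) = q \<nu>" using pos by simp
    have "q \<nu>' = (\<Sum>x\<in>S. (\<nu> x)\<^sup>2 / q \<nu>)"
      unfolding q_def[of \<nu>'] using pos by (intro sum.cong refl) (simp add: \<nu>'_def power_divide)
    also have "\<dots> = 1"
      using pos by (simp add: q_def flip: sum_divide_distrib)
    finally have q': "q \<nu>' = 1" .
    have "\<nu>' x \<in> {-1..1}" if "x \<in> S" for x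
    proof -
      have "(\<nu>' x)\<^sup>2 \<le> q \<nu>'"
        unfolding q_def using S that by (intro member_le_sum) auto
      then show ?thesis
        using q' by (simp add: abs_square_le_1 abs_le_iff)
    qed
    with q' have "\<nu>' \<in> C" by (simp add: C_def \<nu>'_def)
    then have "f \<nu>' \<le> f \<nu>0" by (rule \<nu>0(2))
    moreover have "f \<nu>' = f \<nu> / q \<nu>"
      unfolding f_def sum_divide_distrib using pos by (intro sum.cong refl) (simp add: \<nu>'_def sq)
    ultimately show ?thesis
      using pos by (simp add: divide_le_eq)
  qed
  have "f \<nu>0 < 2" using \<nu>0(1) less2 by (simp add: C_def)
  then show ?thesis
    using bound by (intro exI[of _ "2 - f \<nu>0"]) (simp add: f_def q_def)
qed

section \<open>Stars with four leaves and long cycles\<close>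

abbreviation star_cycles :: "graph set" where
  "star_cycles \<equiv> {complete_bipartite 1 4} \<union> {cycle_graph m | m. m \<ge> 5}"

lemma star_edge_iff:
  "{u, v} \<in> edges (complete_bipartite 1 4) \<longleftrightarrow>
    (u = 0 \<and> 1 \<le> v \<and> v < 5) \<or> (v = 0 \<and> 1 \<le> u \<and> u < 5)"
  by (auto simp: complete_bipartite_def doubleton_eq_iff)

lemma cycle_edge_iff:
  "{u, v} \<in> edges (cycle_graph m) \<longleftrightarrow> (u < m \<and> v = Suc u mod m) \<or> (v < m \<and> u = Suc v mod m)"
  by (auto simp: cycle_graph_def doubleton_eq_iff)

lemma simple_star_cycles: "\<forall>F\<in>star_cycles. simple_graph F"
proof -
  have "simple_graph (complete_bipartite 1 4)"
    by (auto simp: simple_graph_def complete_bipartite_def)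
  moreover have "simple_graph (cycle_graph m)" if "5 \<le> m" for m
  proof -
    have "{i, Suc i mod m} \<in> nsets {..<m} 2" if "i < m" for i
      using that \<open>5 \<le> m\<close> by (auto simp: mod_Suc)
    then show ?thesis
      by (auto simp: simple_graph_def cycle_graph_def simp del: doubleton_in_nsets_2)
  qed
  ultimately show ?thesis by auto
qed

lemma star_maps_toI:
  fixes \<phi> :: "nat \<Rightarrow> nat"
  assumes verts: "\<And>i. i < 5 \<Longrightarrow> \<phi> i \<in> crg_verts K"
    and centre: "\<And>i. 1 \<le> i \<Longrightarrow> i < 5 \<Longrightarrow>
      (\<phi> 0 = \<phi> i \<and> \<phi> 0 \<in> VB K) \<or> {\<phi> 0, \<phi> i} \<in> EB K \<union> EG K"
    and leaves: "\<And>i j. 1 \<le> i \<Longrightarrow> i < j \<Longrightarrow> j < 5 \<Longrightarrow>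
      (\<phi> i = \<phi> j \<and> \<phi> i \<in> VW K) \<or> {\<phi> i, \<phi> j} \<in> EW K \<union> EG K"
  shows "maps_to (complete_bipartite 1 4) K"
  unfolding maps_to_def
proof (intro exI[of _ \<phi>] conjI ballI impI)
  show "\<phi> ` verts (complete_bipartite 1 4) \<subseteq> crg_verts K"
    using verts by (auto simp: complete_bipartite_def)
next
  fix u v assume "{u, v} \<in> edges (complete_bipartite 1 4)"
  then consider "u = 0" "1 \<le> v" "v < 5" | "v = 0" "1 \<le> u" "u < 5"
    unfolding star_edge_iff by blast
  then show "(\<phi> u = \<phi> v \<and> \<phi> u \<in> VB K) \<or> {\<phi> u, \<phi> v} \<in> EB K \<union> EG K"
  proof cases
    case 1
    then show ?thesis using centre[of v] by simp
  next
    case 2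
    then show ?thesis using centre[of u] by (metis insert_commute)
  qed
next
  fix u v
  assume "u \<in> verts (complete_bipartite 1 4)" "v \<in> verts (complete_bipartite 1 4)"
    and "u \<noteq> v \<and> {u, v} \<notin> edges (complete_bipartite 1 4)"
  then have "1 \<le> u" "1 \<le> v" "u < 5" "v < 5" "u \<noteq> v"
    unfolding star_edge_iff by (auto simp: complete_bipartite_def)
  then show "(\<phi> u = \<phi> v \<and> \<phi> u \<in> VW K) \<or> {\<phi> u, \<phi> v} \<in> EW K \<union> EG K"
    using leaves[of u v] leaves[of v u] by (metis insert_commute linorder_neqE_nat)
qed

text \<open>
  The leaves are placed at the white vertex \<open>y\<close> and the center at \<open>x\<close>, whatever the color of \<open>x\<close>.
\<close>

lemma star_maps_to_white_gray:
  assumes "is_crg K" and "y \<in> VW K" and "{x, y} \<in> EG K"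
  shows "maps_to (complete_bipartite 1 4) K"
proof -
  have "{x, y} \<subseteq> crg_verts K"
    using assms crg_edge_card(1)[of K "{x, y}"] by blast
  then show ?thesis
    using assms by (intro star_maps_toI[of "\<lambda>i. if i = 0 then x else y"]) auto
qed

text \<open>
  The center and one leaf are placed together at \<open>x\<close>, and the other three leaves at three gray
  neighbors of \<open>x\<close>. Distinct points of \<open>S\<close> are joined by white or gray edges, so the leaves may be
  non-adjacent.
\<close>

lemma star_maps_to_black_gray:
  assumes K: "is_crg K" and S: "S \<subseteq> VB K" "\<And>a b. a \<in> S \<Longrightarrow> b \<in> S \<Longrightarrow> {a, b} \<notin> EB K"
    and x: "x \<in> S" and A: "A \<subseteq> {y \<in> S. {x, y} \<in> EG K}" "card A = 3"
  shows "maps_to (complete_bipartite 1 4) K"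
proof -
  from A(2) obtain a b c where abc: "A = {a, b, c}" "a \<noteq> b" "a \<noteq> c" "b \<noteq> c"
    by (auto simp: card_3_iff)
  have pair: "{u, v} \<in> EW K \<union> EG K" if "u \<in> S" "v \<in> S" "u \<noteq> v" for u v
  proof -
    have "{u, v} \<in> nsets (crg_verts K) 2"
      using that S(1) by (auto simp: crg_verts_def)
    then show ?thesis
      using K S(2)[OF that(1,2)] unfolding is_crg_def by blast
  qed
  have in_S: "a \<in> S" "b \<in> S" "c \<in> S"
    and gray: "{x, a} \<in> EG K" "{x, b} \<in> EG K" "{x, c} \<in> EG K"
    using A abc by auto
  have pairs: "{a, b} \<in> EW K \<union> EG K" "{a, c} \<in> EW K \<union> EG K" "{b, c} \<in> EW K \<union> EG K"
    using pair in_S abc by auto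
  show ?thesis
  proof (rule star_maps_toI[of "\<lambda>i. [x, x, a, b, c] ! i"])
    have five: "i \<in> {0, 1, 2, 3, 4}" if "i < 5" for i :: nat
      using that by auto
    show "[x, x, a, b, c] ! i \<in> crg_verts K" if "i < 5" for i
      using five[OF that] S(1) x in_S by (auto simp: crg_verts_def)
    show "([x, x, a, b, c] ! 0 = [x, x, a, b, c] ! i \<and> [x, x, a, b, c] ! 0 \<in> VB K) \<or>
        {[x, x, a, b, c] ! 0, [x, x, a, b, c] ! i} \<in> EB K \<union> EG K" if "1 \<le> i" "i < 5" for i
      using five[OF that(2)] that(1) S(1) x gray by auto
    show "([x, x, a, b, c] ! i = [x, x, a, b, c] ! j \<and> [x, x, a, b, c] ! i \<in> VW K) \<or>
        {[x, x, a, b, c] ! i, [x, x, a, b, c] ! j} \<in> EW K \<union> EG K"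
      if "1 \<le> i" "i < j" "j < 5" for i j
    proof -
      have "i \<in> {1, 2, 3}" "j \<in> {2, 3, 4}" using that by auto
      then show ?thesis using \<open>i < j\<close> gray pairs by auto
    qed
  qed
qed

text \<open>
  A cycle of length \<open>2 * k\<close> is folded onto a gray cycle of length \<open>k\<close> by placing consecutive vertices
  in pairs. Taking the double length covers gray triangles and gray 4-cycles together with the
  longer ones, since \<open>2 * k \<ge> 6\<close> whenever \<open>k \<ge> 3\<close>.
\<close>

lemma cycle_maps_to_gray_cycle:
  assumes K: "is_crg K" and S: "S \<subseteq> VB K" "\<And>a b. a \<in> S \<Longrightarrow> b \<in> S \<Longrightarrow> {a, b} \<notin> EB K"
    and k: "3 \<le> k" and c: "inj_on c {..<k}" "c ` {..<k} \<subseteq> S"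
    and gray: "\<And>i. i < k \<Longrightarrow> {c i, c (Suc i mod k)} \<in> EG K"
  shows "maps_to (cycle_graph (2 * k)) K"
proof -
  have cS: "c (u div 2) \<in> S" if "u < 2 * k" for u
    using that c(2) by auto
  have edge: "(c (u div 2) = c (v div 2) \<and> c (u div 2) \<in> VB K) \<or> {c (u div 2), c (v div 2)} \<in> EG K"
    if u: "u < 2 * k" and v: "v = Suc u mod (2 * k)" for u v
  proof (cases "even u")
    case True
    then have "Suc u < 2 * k" using u by presburger
    then have "v div 2 = u div 2" using True v by simp
    then show ?thesis using cS[OF u] S(1) by auto
  next
    case False
    have "v div 2 = Suc (u div 2) mod k"
    proof (cases "Suc u = 2 * k")
      case True
      then have "Suc (u div 2) = k" by presburger
      then show ?thesis using True v by simp
    next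
      case neq: False
      then have "Suc u < 2 * k" "Suc (u div 2) < k" using u False by presburger+
      then show ?thesis using v False by simp
    qed
    then show ?thesis using gray[of "u div 2"] u by simp
  qed
  have nonedge: "{c (u div 2), c (v div 2)} \<in> EW K \<union> EG K"
    if uv: "u < 2 * k" "v < 2 * k" "u \<noteq> v" "{u, v} \<notin> edges (cycle_graph (2 * k))" for u v
  proof -
    have "u div 2 \<noteq> v div 2"
    proof
      assume "u div 2 = v div 2"
      then have "(even u \<and> v = Suc u) \<or> (even v \<and> u = Suc v)"
        using uv(3) by presburger
      then show False
        using uv by (auto simp: cycle_edge_iff)
    qed
    moreover have "u div 2 < k" "v div 2 < k" using uv by auto
    ultimately have "c (u div 2) \<noteq> c (v div 2)"
      using c(1) by (auto simp: inj_on_def)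
    then have "{c (u div 2), c (v div 2)} \<in> nsets (crg_verts K) 2"
      using cS uv S(1) by (auto simp: crg_verts_def)
    then show ?thesis
      using K S(2)[OF cS[OF uv(1)] cS[OF uv(2)]] unfolding is_crg_def by blast
  qed
  show ?thesis
    unfolding maps_to_def
  proof (intro exI[of _ "\<lambda>u. c (u div 2)"] conjI ballI impI)
    show "(\<lambda>u. c (u div 2)) ` verts (cycle_graph (2 * k)) \<subseteq> crg_verts K"
      using cS S(1) by (auto simp: cycle_graph_def crg_verts_def)
  next
    fix u v assume "{u, v} \<in> edges (cycle_graph (2 * k))"
    then consider "u < 2 * k" "v = Suc u mod (2 * k)" | "v < 2 * k" "u = Suc v mod (2 * k)"
      unfolding cycle_edge_iff by blast
    then show "(c (u div 2) = c (v div 2) \<and> c (u div 2) \<in> VB K) \<or>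
        {c (u div 2), c (v div 2)} \<in> EB K \<union> EG K"
    proof cases
      case 1
      from edge[OF this] show ?thesis by blast
    next
      case 2
      from edge[OF this] show ?thesis
        unfolding insert_commute[of "c (v div 2)" "c (u div 2)"] by auto
    qed
  next
    fix u v assume "u \<in> verts (cycle_graph (2 * k))" "v \<in> verts (cycle_graph (2 * k))"
      and e: "u \<noteq> v \<and> {u, v} \<notin> edges (cycle_graph (2 * k))"
    then have "u < 2 * k" "v < 2 * k" by (simp_all add: cycle_graph_def)
    with e show "(c (u div 2) = c (v div 2) \<and> c (u div 2) \<in> VW K) \<or>
        {c (u div 2), c (v div 2)} \<in> EW K \<union> EG K"
      using nonedge[of u v] by blast
  qed
qed

text \<open>
  On black vertices without black edges between them, the gray edges form disjoint paths: a vertex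
  with three gray neighbors would admit the star, and a gray cycle would admit a long cycle.
\<close>

lemma gray_form_gap:
  assumes K: "is_crg K" "\<not> family_maps_to star_cycles K"
    and S: "S \<subseteq> VB K" "\<And>a b. a \<in> S \<Longrightarrow> b \<in> S \<Longrightarrow> {a, b} \<notin> EB K"
  shows "\<exists>c>0. \<forall>\<nu>::nat \<Rightarrow> real.
    (\<Sum>x\<in>S. \<Sum>y | y \<in> S \<and> {x, y} \<in> EG K. \<nu> x * \<nu> y) \<le> (2 - c) * (\<Sum>x\<in>S. (\<nu> x)\<^sup>2)"
proof (rule adjacency_form_gap)
  have "finite (VB K)"
    using K(1) by (simp add: is_crg_def crg_verts_def)
  then show fin: "finite S"
    using S(1) by (rule rev_finite_subset)
  show "{y, x} \<in> EG K" if "{x, y} \<in> EG K" for x y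
    using that by (simp add: insert_commute)
  show "card {y \<in> S. {x, y} \<in> EG K} \<le> 2" if "x \<in> S" for x
  proof (rule ccontr)
    assume "\<not> ?thesis"
    then have "3 \<le> card {y \<in> S. {x, y} \<in> EG K}" by simp
    then obtain A where "A \<subseteq> {y \<in> S. {x, y} \<in> EG K}" "card A = 3"
      by (rule obtain_subset_with_card_n)
    then have "maps_to (complete_bipartite 1 4) K"
      using star_maps_to_black_gray[OF K(1) S that] by blast
    then show False using K(2) by (auto simp: family_maps_to_def)
  qed
  show "\<exists>x\<in>T. card {y \<in> S. {x, y} \<in> EG K} \<noteq> 2 \<or> \<not> {y \<in> S. {x, y} \<in> EG K} \<subseteq> T"
    if T: "T \<subseteq> S" "T \<noteq> {}" for T
  proof (rule ccontr)
    assume "\<not> ?thesis"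
    then have two: "card {y \<in> S. {x, y} \<in> EG K} = 2" "{y \<in> S. {x, y} \<in> EG K} \<subseteq> T" if "x \<in> T" for x
      using that by auto
    have "\<exists>k\<ge>3. \<exists>c. inj_on c {..<k} \<and> c ` {..<k} \<subseteq> T \<and> (\<forall>i<k. {c i, c (Suc i mod k)} \<in> EG K)"
    proof (rule cycle_if_min_degree_two)
      show "finite T" using T fin finite_subset by blast
      show "T \<noteq> {}" by (rule T(2))
      show "\<exists>y\<in>T. \<exists>z\<in>T. y \<noteq> z \<and> {x, y} \<in> EG K \<and> {x, z} \<in> EG K" if xT: "x \<in> T" for x
      proof -
        obtain y z where "{y \<in> S. {x, y} \<in> EG K} = {y, z}" "y \<noteq> z"
          using two(1)[OF xT] by (auto simp: card_2_iff)
        then show ?thesis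
          using two(2)[OF xT] by blast
      qed
      show "{x, x} \<notin> EG K" for x
        using crg_edge_card(2)[OF K(1), of "{x, x}"] by auto
    qed
    then obtain k c where k: "3 \<le> k" and c: "inj_on c {..<k}" "c ` {..<k} \<subseteq> T"
      "\<And>i. i < k \<Longrightarrow> {c i, c (Suc i mod k)} \<in> EG K"
      by blast
    have "maps_to (cycle_graph (2 * k)) K"
      using c T(1) by (intro cycle_maps_to_gray_cycle[OF K(1) S k, of c]) auto
    moreover have "5 \<le> 2 * k" using k by simp
    ultimately show False
      using K(2) unfolding family_maps_to_def by blast
  qed
qed

text \<open>
  After shifting mass, no two black vertices of the support are joined by a black edge, because for such
  a pair all four entries of the matrix equal \<open>1 - p\<close>. Now compare every matrix entry with \<open>p\<close>. White
  vertices have no gray edges, so the entries in their rows are at least \<open>p\<close>. Between black vertices of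
  the support, the entries exceed \<open>p\<close> by \<open>1 - 2 * p\<close> on the diagonal, by \<open>- p\<close> on gray edges and by 0
  otherwise; the assumption \<open>gray\<close> says that these contributions add up to something non-negative.
\<close>

lemma crg_form_ge:
  assumes K: "is_crg K" "\<not> family_maps_to star_cycles K"
    and p: "0 \<le> p" "p \<le> 1 / 2"
    and gray: "\<And>S \<nu>. S \<subseteq> VB K \<Longrightarrow> (\<And>a b. a \<in> S \<Longrightarrow> b \<in> S \<Longrightarrow> {a, b} \<notin> EB K) \<Longrightarrow>
      p * (\<Sum>x\<in>S. \<Sum>y | y \<in> S \<and> {x, y} \<in> EG K. \<nu> x * \<nu> y) \<le> (1 - 2 * p) * (\<Sum>x\<in>S. (\<nu> x)\<^sup>2)"
    and \<mu>: "\<mu> \<in> prob_masses K"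
  shows "p \<le> crg_form K p \<mu>"
proof -
  let ?V = "crg_verts K" and ?M = "crg_matrix K p"
  have V: "finite ?V" and sum\<mu>: "sum \<mu> ?V = 1"
    using K(1) \<mu> by (auto simp: is_crg_def prob_masses_def)
  have sym: "?M x y = ?M y x" for x y
    by (simp add: crg_matrix_pairs[OF K(1)] insert_commute)
  obtain \<nu> where nn: "\<And>x. 0 \<le> \<nu> x" and sum\<nu>: "sum \<nu> ?V = 1"
    and le: "crg_form K p \<nu> \<le> crg_form K p \<mu>"
    and core: "\<And>x y. x \<in> ?V \<Longrightarrow> y \<in> ?V \<Longrightarrow> x \<noteq> y \<Longrightarrow> \<nu> x \<noteq> 0 \<Longrightarrow> \<nu> y \<noteq> 0 \<Longrightarrow>
      2 * ?M x y < ?M x x + ?M y y"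
  proof -
    have "\<And>x. 0 \<le> \<mu> x" using \<mu> by (simp add: prob_masses_def)
    from shift_mass[of ?V ?M \<mu>, OF V sym this] obtain \<nu> where "\<forall>x. 0 \<le> \<nu> x" "sum \<nu> ?V = sum \<mu> ?V"
      "(\<Sum>x\<in>?V. \<nu> x * (\<Sum>y\<in>?V. ?M x y * \<nu> y)) \<le> (\<Sum>x\<in>?V. \<mu> x * (\<Sum>y\<in>?V. ?M x y * \<mu> y))"
      "\<forall>x\<in>?V. \<forall>y\<in>?V. x \<noteq> y \<and> \<nu> x \<noteq> 0 \<and> \<nu> y \<noteq> 0 \<longrightarrow> 2 * ?M x y < ?M x x + ?M y y"
      by blast
    then show thesis
      using sum\<mu> by (intro that[of \<nu>]) (simp_all add: crg_form_def)
  qed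
  define S where "S = {x \<in> VB K. \<nu> x \<noteq> 0}"
  have S: "S \<subseteq> VB K" "S \<subseteq> ?V" by (auto simp: S_def crg_verts_def)
  have finS: "finite S" using S(2) V finite_subset by blast
  have single: "{x} \<notin> EB K \<union> EW K \<union> EG K" for x
    using crg_edge_card(2)[OF K(1), of "{x}"] by auto
  have disj: "VB K \<inter> VW K = {}" "EB K \<inter> EW K = {}" "EB K \<inter> EG K = {}" "EW K \<inter> EG K = {}"
    using K(1) by (auto simp: is_crg_def)
  have black_diag: "?M x x = 1 - p" if "x \<in> VB K" for x
    using that single disj(1) by (auto simp: crg_matrix_def)
  have noblack: "{x, y} \<notin> EB K" if "x \<in> S" "y \<in> S" for x y
  proof
    assume e: "{x, y} \<in> EB K"
    then have "x \<noteq> y" using single by auto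
    moreover have "?M x y = 1 - p"
      using e disj(2) \<open>x \<noteq> y\<close> by (auto simp: crg_matrix_def)
    ultimately show False
      using core[of x y] that S black_diag[of x] black_diag[of y] by (auto simp: S_def)
  qed
  have white_row: "p \<le> ?M x y" if xy: "x \<in> ?V" "y \<in> ?V" "x \<in> VW K \<or> y \<in> VW K" for x y
  proof -
    have "\<not> maps_to (complete_bipartite 1 4) K"
      using K(2) by (auto simp: family_maps_to_def)
    then have "{x, y} \<notin> EG K"
      using star_maps_to_white_gray[OF K(1), of x y] star_maps_to_white_gray[OF K(1), of y x] xy(3)
      by (metis insert_commute)
    then show ?thesis
      using pair_kinds[OF K(1) xy(1,2)] p by (auto simp: crg_matrix_pairs[OF K(1)])
  qed
  define T where "T x y = \<nu> x * \<nu> y * (?M x y - p)" for x y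
  have "crg_form K p \<nu> - p = (\<Sum>x\<in>?V. \<Sum>y\<in>?V. T x y)"
  proof -
    have "(\<Sum>x\<in>?V. \<Sum>y\<in>?V. \<nu> x * \<nu> y * p) = p"
      using sum\<nu> by (simp add: mult.assoc flip: sum_distrib_left sum_distrib_right)
    then show ?thesis
      by (simp add: T_def crg_form_def right_diff_distrib sum_subtractf sum_distrib_left mult_ac)
  qed
  also have "\<dots> = (\<Sum>(x, y)\<in>?V \<times> ?V. T x y)"
    by (simp add: sum.cartesian_product)
  also have "\<dots> \<ge> (\<Sum>(x, y)\<in>S \<times> S. T x y)"
  proof (rule sum_mono2)
    show "finite (?V \<times> ?V)" using V by simp
    show "S \<times> S \<subseteq> ?V \<times> ?V" using S by auto
    fix xy assume xy: "xy \<in> ?V \<times> ?V - S \<times> S"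
    obtain x y where [simp]: "xy = (x, y)" by force
    show "0 \<le> (case xy of (x, y) \<Rightarrow> T x y)"
    proof (cases "\<nu> x = 0 \<or> \<nu> y = 0")
      case True
      then show ?thesis by (auto simp: T_def)
    next
      case False
      then have "x \<in> VW K \<or> y \<in> VW K"
        using xy by (auto simp: S_def crg_verts_def)
      then show ?thesis
        using white_row[of x y] xy nn by (auto simp: T_def)
    qed
  qed
  finally have "(\<Sum>x\<in>S. \<Sum>y\<in>S. T x y) \<le> crg_form K p \<nu> - p"
    by (simp add: sum.cartesian_product)
  moreover have "(\<Sum>y\<in>S. T x y) = (1 - 2 * p) * (\<nu> x)\<^sup>2 - p * (\<Sum>y | y \<in> S \<and> {x, y} \<in> EG K. \<nu> x * \<nu> y)"
    if "x \<in> S" for x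
  proof -
    have eq: "?M x y - p = (1 - 2 * p) * of_bool (y = x) - p * of_bool ({x, y} \<in> EG K)" if "y \<in> S" for y
    proof (cases "y = x")
      case True
      then show ?thesis using black_diag[of x] S \<open>x \<in> S\<close> single by auto
    next
      case False
      then have "{x, y} \<in> nsets ?V 2" using S \<open>x \<in> S\<close> \<open>y \<in> S\<close> by auto
      then have "{x, y} \<in> EW K \<union> EG K"
        using noblack[OF \<open>x \<in> S\<close> \<open>y \<in> S\<close>] K(1) unfolding is_crg_def by blast
      then show ?thesis
        using False disj by (auto simp: crg_matrix_def)
    qed
    have "(\<Sum>y\<in>S. T x y) =
      (\<Sum>y\<in>S. (1 - 2 * p) * (\<nu> x * \<nu> y * of_bool (y = x)) - p * (\<nu> x * \<nu> y * of_bool ({x, y} \<in> EG K)))"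
      unfolding T_def by (intro sum.cong refl) (simp only: eq right_diff_distrib mult_ac)
    also have "\<dots> = (1 - 2 * p) * (\<Sum>y\<in>S. \<nu> x * \<nu> y * of_bool (y = x)) -
        p * (\<Sum>y\<in>S. \<nu> x * \<nu> y * of_bool ({x, y} \<in> EG K))"
      by (simp only: sum_subtractf sum_distrib_left)
    also have "(\<Sum>y\<in>S. \<nu> x * \<nu> y * of_bool (y = x)) = (\<nu> x)\<^sup>2"
      using finS that by (simp add: of_bool_def if_distrib power2_eq_square cong: if_cong)
    also have "(\<Sum>y\<in>S. \<nu> x * \<nu> y * of_bool ({x, y} \<in> EG K)) =
        (\<Sum>y | y \<in> S \<and> {x, y} \<in> EG K. \<nu> x * \<nu> y)"
      using finS by (simp add: Int_def)
    finally show ?thesis .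
  qed
  then have "(\<Sum>x\<in>S. \<Sum>y\<in>S. T x y) =
    (1 - 2 * p) * (\<Sum>x\<in>S. (\<nu> x)\<^sup>2) - p * (\<Sum>x\<in>S. \<Sum>y | y \<in> S \<and> {x, y} \<in> EG K. \<nu> x * \<nu> y)"
    by (simp add: sum_subtractf sum_distrib_left)
  ultimately show ?thesis
    using gray[of S \<nu>, OF S(1) noblack] le by simp
qed

text \<open>
  At \<open>p = 1 / 4\<close> the ratio \<open>(1 - 2 * p) / p\<close> equals 2, which is strictly above the largest eigenvalue
  of each of the finitely many gray graphs inside \<open>K\<close>, so it stays above for a while.
\<close>

lemma eventually_crg_form_ge:
  assumes K: "is_crg K" "\<not> family_maps_to star_cycles K"
  shows "\<forall>\<^sub>F p in at_right (1 / 4). \<forall>\<mu>\<in>prob_masses K. p \<le> crg_form K p \<mu>"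
proof -
  let ?\<S> = "{S. S \<subseteq> VB K \<and> (\<forall>a\<in>S. \<forall>b\<in>S. {a, b} \<notin> EB K)}"
  let ?f = "\<lambda>S \<nu>. \<Sum>x\<in>S. \<Sum>y | y \<in> S \<and> {x, y} \<in> EG K. \<nu> x * \<nu> y :: real"
  have "finite (VB K)"
    using K(1) by (simp add: is_crg_def crg_verts_def)
  then have fin: "finite ?\<S>" by simp
  have "\<forall>\<^sub>F p in at_right (1 / 4). \<forall>\<nu>. p * ?f S \<nu> \<le> (1 - 2 * p) * (\<Sum>x\<in>S. (\<nu> x)\<^sup>2)"
    if S: "S \<in> ?\<S>" for S
  proof -
    have "\<exists>c>0. \<forall>\<nu>. ?f S \<nu> \<le> (2 - c) * (\<Sum>x\<in>S. (\<nu> x)\<^sup>2)"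
      using S by (intro gray_form_gap[OF K]) auto
    then obtain c where c: "0 < c" "\<And>\<nu>. ?f S \<nu> \<le> (2 - c) * (\<Sum>x\<in>S. (\<nu> x)\<^sup>2)" by blast
    have "((\<lambda>p. 1 - 2 * p - p * (2 - c)) \<longlongrightarrow> 1 - 2 * (1 / 4) - (1 / 4) * (2 - c)) (at_right (1 / 4))"
      by (intro tendsto_intros)
    then have "\<forall>\<^sub>F p in at_right (1 / 4). 0 < 1 - 2 * p - p * (2 - c)"
      using c(1) by (elim order_tendstoD(1)) simp
    with eventually_at_right_less show ?thesis
    proof eventually_elim
      case (elim p)
      show ?case
      proof
        fix \<nu> :: "nat \<Rightarrow> real"
        let ?q = "\<Sum>x\<in>S. (\<nu> x)\<^sup>2"
        have "p * ?f S \<nu> \<le> p * ((2 - c) * ?q)"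
          using c(2) elim by (intro mult_left_mono) auto
        also have "\<dots> \<le> (1 - 2 * p) * ?q"
          using elim sum_nonneg[of S "\<lambda>x. (\<nu> x)\<^sup>2"]
          by (subst mult.assoc[symmetric], intro mult_right_mono) auto
        finally show "p * ?f S \<nu> \<le> (1 - 2 * p) * ?q" .
      qed
    qed
  qed
  then have "\<forall>\<^sub>F p in at_right (1 / 4). \<forall>S\<in>?\<S>. \<forall>\<nu>. p * ?f S \<nu> \<le> (1 - 2 * p) * (\<Sum>x\<in>S. (\<nu> x)\<^sup>2)"
    by (intro eventually_ball_finite[OF fin] ballI)
  moreover have "\<forall>\<^sub>F p in at_right (1 / 4). p < (1 / 2 :: real)"
    by (rule eventually_at_rightI[of _ "1 / 2"]) auto
  ultimately show ?thesis
    using eventually_at_right_less[of "1 / 4 :: real"]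
  proof eventually_elim
    case (elim p)
    show ?case
    proof
      fix \<mu> assume "\<mu> \<in> prob_masses K"
      then show "p \<le> crg_form K p \<mu>"
        using elim by (intro crg_form_ge[OF K]) auto
    qed
  qed
qed

section \<open>Gray paths of black vertices\<close>

definition gray_path :: "nat \<Rightarrow> crg" where
  "gray_path n =
    \<lparr>VB = {..<n}, VW = {}, EB = {}, EW = nsets {..<n} 2 - {{i, Suc i} | i. Suc i < n},
     EG = {{i, Suc i} | i. Suc i < n}\<rparr>"

lemma is_crg_gray_path: "0 < n \<Longrightarrow> is_crg (gray_path n)"
  by (auto simp: is_crg_def gray_path_def crg_verts_def)

lemma gray_path_gray_iff:
  "{a, b} \<in> EG (gray_path n) \<longleftrightarrow> (b = Suc a \<and> b < n) \<or> (a = Suc b \<and> a < n)"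
  by (auto simp: gray_path_def doubleton_eq_iff)

text \<open>
  On a gray path, adjacent vertices are placed at most one step apart, and non-adjacent vertices at
  different places. Both conclusions speak only of the positions, so the excluded graphs can be
  treated by arithmetic.
\<close>

lemma maps_to_gray_path:
  assumes "maps_to F (gray_path n)"
  shows "\<exists>\<phi>::nat \<Rightarrow> nat. \<forall>u\<in>verts F. \<forall>v\<in>verts F.
    ({u, v} \<in> edges F \<longrightarrow> \<phi> u \<le> Suc (\<phi> v) \<and> \<phi> v \<le> Suc (\<phi> u)) \<and>
    (u \<noteq> v \<and> {u, v} \<notin> edges F \<longrightarrow> \<phi> u \<noteq> \<phi> v)"
proof -
  obtain \<phi> where \<phi>: "\<And>u v. u \<in> verts F \<Longrightarrow> v \<in> verts F \<Longrightarrow> {u, v} \<in> edges F \<Longrightarrow>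
      (\<phi> u = \<phi> v \<and> \<phi> u \<in> VB (gray_path n)) \<or> {\<phi> u, \<phi> v} \<in> EB (gray_path n) \<union> EG (gray_path n)"
    "\<And>u v. u \<in> verts F \<Longrightarrow> v \<in> verts F \<Longrightarrow> u \<noteq> v \<and> {u, v} \<notin> edges F \<Longrightarrow>
      (\<phi> u = \<phi> v \<and> \<phi> u \<in> VW (gray_path n)) \<or> {\<phi> u, \<phi> v} \<in> EW (gray_path n) \<union> EG (gray_path n)"
    using assms unfolding maps_to_def by metis
  have empty: "EB (gray_path n) = {}" "VW (gray_path n) = {}" by (simp_all add: gray_path_def)
  have loop: "{a, a} \<notin> EW (gray_path n) \<union> EG (gray_path n)" for a
    by (auto simp: gray_path_def doubleton_eq_iff nsets_def)
  show ?thesis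
  proof (intro exI[of _ \<phi>] ballI conjI impI)
    fix u v assume uv: "u \<in> verts F" "v \<in> verts F"
    {
      assume "{u, v} \<in> edges F"
      from \<phi>(1)[OF uv this] have "\<phi> u = \<phi> v \<or> \<phi> v = Suc (\<phi> u) \<or> \<phi> u = Suc (\<phi> v)"
        unfolding empty Un_iff gray_path_gray_iff by blast
      then show "\<phi> u \<le> Suc (\<phi> v)" "\<phi> v \<le> Suc (\<phi> u)" by auto
    }
    assume "u \<noteq> v \<and> {u, v} \<notin> edges F"
    from \<phi>(2)[OF uv this] show "\<phi> u \<noteq> \<phi> v"
      using loop unfolding empty by (metis empty_iff)
  qed
qed

text \<open>
  The four leaves would need four different positions within distance one of the center.
\<close>

lemma star_not_maps_to_gray_path: "\<not> maps_to (complete_bipartite 1 4) (gray_path n)"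
proof
  assume *: "maps_to (complete_bipartite 1 4) (gray_path n)"
  have V: "verts (complete_bipartite 1 4) = {0, 1, 2, 3, 4}"
    by (auto simp: complete_bipartite_def)
  from maps_to_gray_path[OF *] obtain \<phi> :: "nat \<Rightarrow> nat" where
    "\<forall>u\<in>{0, 1, 2, 3, 4}. \<forall>v\<in>{0, 1, 2, 3, 4}.
      ({u, v} \<in> edges (complete_bipartite 1 4) \<longrightarrow> \<phi> u \<le> Suc (\<phi> v) \<and> \<phi> v \<le> Suc (\<phi> u)) \<and>
      (u \<noteq> v \<and> {u, v} \<notin> edges (complete_bipartite 1 4) \<longrightarrow> \<phi> u \<noteq> \<phi> v)"
    unfolding V by blast
  then have near: "\<forall>i\<in>{1, 2, 3, 4}. \<phi> 0 \<le> Suc (\<phi> i) \<and> \<phi> i \<le> Suc (\<phi> 0)"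
    and distinct: "\<forall>i\<in>{1, 2, 3, 4}. \<forall>j\<in>{1, 2, 3, 4}. i \<noteq> j \<longrightarrow> \<phi> i \<noteq> \<phi> j"
    unfolding star_edge_iff by simp_all
  have "\<phi> ` {1, 2, 3, 4} \<subseteq> {\<phi> 0 - 1..\<phi> 0 + 1}"
    using near by auto
  then have "card (\<phi> ` {1, 2, 3, 4}) \<le> card {\<phi> 0 - 1..\<phi> 0 + 1}"
    by (intro card_mono) auto
  moreover have "inj_on \<phi> {1, 2, 3, 4}"
    using distinct unfolding inj_on_def by blast
  ultimately show False
    by (simp add: card_image)
qed

text \<open>
  Let \<open>a\<close> be the least position that occurs along the cycle. The two neighbors of a vertex at \<open>a\<close> are not
  adjacent to each other, so they are at \<open>a\<close> and \<open>Suc a\<close>, in some order. The other neighbor of the one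
  at \<open>a\<close> is not adjacent to the vertex itself, so it can only be at \<open>Suc a\<close>, where the first pair
  already has a member. These two vertices at \<open>Suc a\<close> are three steps apart, hence non-adjacent in
  a cycle of length at least 5.
\<close>

lemma cycle_not_maps_to_gray_path:
  assumes m: "5 \<le> m"
  shows "\<not> maps_to (cycle_graph m) (gray_path n)"
proof
  assume *: "maps_to (cycle_graph m) (gray_path n)"
  have V: "verts (cycle_graph m) = {..<m}"
    by (simp add: cycle_graph_def)
  from maps_to_gray_path[OF *] obtain \<phi> :: "nat \<Rightarrow> nat" where
    \<phi>: "\<And>u v. u < m \<Longrightarrow> v < m \<Longrightarrow> {u, v} \<in> edges (cycle_graph m) \<Longrightarrow>
      \<phi> u \<le> Suc (\<phi> v) \<and> \<phi> v \<le> Suc (\<phi> u)"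
    "\<And>u v. u < m \<Longrightarrow> v < m \<Longrightarrow> u \<noteq> v \<Longrightarrow> {u, v} \<notin> edges (cycle_graph m) \<Longrightarrow> \<phi> u \<noteq> \<phi> v"
    unfolding V by (simp add: Ball_def) blast
  \<comment> \<open>Positions along the cycle, indexed periodically.\<close>
  define b where "b k = \<phi> (k mod m)" for k
  have step: "b k \<le> Suc (b (Suc k)) \<and> b (Suc k) \<le> Suc (b k)" for k
    unfolding b_def using m by (intro \<phi>(1)) (auto simp: cycle_edge_iff mod_Suc_eq)
  have far: "b k \<noteq> b (k + d)" if "d = 2 \<or> d = 3" for k d
  proof -
    define x where "x = k mod m"
    have x: "x < m" using m by (simp add: x_def)
    define y where "y = (if x + d < m then x + d else x + d - m)"
    have y: "y < m" using x m that by (auto simp: y_def)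
    have "(k + d) mod m = (x + d) mod m" by (simp add: x_def mod_add_left_eq)
    then have kd: "(k + d) mod m = y"
      using x m that by (auto simp: y_def le_mod_geq)
    have "Suc z mod m = (if Suc z = m then 0 else Suc z)" if "z < m" for z
      using that by auto
    then have "{x, y} \<notin> edges (cycle_graph m)" "x \<noteq> y"
      unfolding cycle_edge_iff using x y m that by (auto simp: y_def split: if_splits)
    then show ?thesis
      unfolding b_def kd x_def[symmetric] using x y by (intro \<phi>(2))
  qed
  obtain i where i: "\<And>k. b i \<le> b k"
    using ex_has_least_nat[of "\<lambda>_. True" 0 b] by auto
  \<comment> \<open>Going once around the cycle makes room for the two vertices before the lowest one, which has
    index j + 2.\<close>
  define j where "j = i + m - 2"
  have j: "b (j + 2) = b i"
  proof -
    have "j + 2 = i + m" using m by (simp add: j_def)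
    then show ?thesis by (simp add: b_def)
  qed
  have "b (j + 2) \<le> b j" "b (j + 2) \<le> b (j + 1)" "b (j + 2) \<le> b (j + 3)" "b (j + 2) \<le> b (j + 4)"
    unfolding j by (rule i)+
  moreover have "b (j + 2) \<le> Suc (b (j + 1)) \<and> b (j + 1) \<le> Suc (b (j + 2))"
    "b (j + 3) \<le> Suc (b (j + 2)) \<and> b (j + 2) \<le> Suc (b (j + 3))"
    "b j \<le> Suc (b (j + 1)) \<and> b (j + 1) \<le> Suc (b j)"
    "b (j + 4) \<le> Suc (b (j + 3)) \<and> b (j + 3) \<le> Suc (b (j + 4))"
    using step[of j] step[of "j + 1"] step[of "j + 2"] step[of "j + 3"]
    by (simp_all add: eval_nat_numeral)
  moreover have "b (j + 1) \<noteq> b (j + 3)" "b j \<noteq> b (j + 2)" "b (j + 2) \<noteq> b (j + 4)"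
    "b j \<noteq> b (j + 3)" "b (j + 1) \<noteq> b (j + 4)"
    using far[of 2 j] far[of 2 "j + 1"] far[of 2 "j + 2"] far[of 3 j] far[of 3 "j + 1"]
    by (simp_all add: eval_nat_numeral)
  ultimately show False by linarith
qed

lemma gray_path_admissible:
  assumes "0 < n"
  shows "is_crg (gray_path n)" "\<not> family_maps_to star_cycles (gray_path n)"
  using is_crg_gray_path[OF assms] star_not_maps_to_gray_path cycle_not_maps_to_gray_path
  unfolding family_maps_to_def by blast+

text \<open>
  Complete graphs map to a single black vertex, so all of them belong to the property.
\<close>

lemma nontrivial_Forb_star_cycles: "nontrivial (Forb star_cycles)"
  unfolding nontrivial_def
proof
  fix n
  let ?G = "\<lparr>verts = {..<n}, edges = nsets {..<n} 2\<rparr>"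
  have G: "simple_graph ?G"
    by (simp add: simple_graph_def)
  have "maps_to ?G (gray_path 1)"
    unfolding maps_to_def by (intro exI[of _ "\<lambda>_. 0"]) (auto simp: gray_path_def crg_verts_def)
  then have "?G \<in> Forb star_cycles"
    using G gray_path_admissible(2)[of 1] by (intro in_Forb_if_maps_to) auto
  then show "\<exists>G\<in>Forb star_cycles. n \<le> card (verts G)"
    by (rule bexI[rotated]) simp
qed

text \<open>
  With uniform mass on a path of \<open>n\<close> vertices the form is \<open>p + (2 * p - n * (4 * p - 1)) / n\<^sup>2\<close>: the
  \<open>n\<close> diagonal entries exceed \<open>p\<close> by \<open>1 - 2 * p\<close> and the \<open>2 * (n - 1)\<close> gray entries fall short by \<open>p\<close>.
\<close>

lemma gray_path_form_less:
  assumes p: "1 / 4 < p"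
  shows "\<exists>n>0. \<exists>\<mu>\<in>prob_masses (gray_path n). crg_form (gray_path n) p \<mu> < p"
proof -
  obtain n :: nat where n: "2 * p / (4 * p - 1) < n"
    using reals_Archimedean2 by blast
  then have big: "2 * p < n * (4 * p - 1)"
    using p by (simp add: divide_less_eq)
  then have n0: "0 < n"
    using p by (cases n) auto
  define \<mu> where "\<mu> x = (if x < n then 1 / real n else 0)" for x
  have V: "crg_verts (gray_path n) = {..<n}"
    by (simp add: crg_verts_def gray_path_def)
  have \<mu>: "\<mu> \<in> prob_masses (gray_path n)"
    using n0 by (simp add: prob_masses_def V \<mu>_def)
  have M: "crg_matrix (gray_path n) p x y =
      p + (1 - 2 * p) * of_bool (y = x) - p * of_bool (y = Suc x) - p * of_bool (x = Suc y)"
    if "x < n" "y < n" for x y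
    using that by (auto simp: crg_matrix_def gray_path_def doubleton_eq_iff)
  have succ: "(\<Sum>x<n. \<Sum>y<n. of_bool (y = Suc x) :: real) = real n - 1"
  proof -
    have "(\<Sum>y<n. of_bool (y = Suc x) :: real) = of_bool (Suc x < n)" for x
      by (simp add: of_bool_def)
    moreover obtain m where "n = Suc m" using n0 gr0_implies_Suc by blast
    moreover have "(\<Sum>x<m. of_bool (x < m) :: real) = (\<Sum>x<m. 1)"
      by (intro sum.cong) auto
    ultimately show ?thesis
      by (simp only: sum.lessThan_Suc) simp
  qed
  have "crg_form (gray_path n) p \<mu> = (\<Sum>x<n. \<Sum>y<n. crg_matrix (gray_path n) p x y) / (real n)\<^sup>2"
    by (simp add: crg_form_def V \<mu>_def sum_divide_distrib power2_eq_square)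
  also have "(\<Sum>x<n. \<Sum>y<n. crg_matrix (gray_path n) p x y) =
      (\<Sum>x<n. \<Sum>y<n. p + (1 - 2 * p) * of_bool (y = x) - p * of_bool (y = Suc x) - p * of_bool (x = Suc y))"
    using M by (intro sum.cong refl) auto
  also have "\<dots> = p * (real n)\<^sup>2 + (1 - 2 * p) * (\<Sum>x<n. \<Sum>y<n. of_bool (y = x)) -
      p * (\<Sum>x<n. \<Sum>y<n. of_bool (y = Suc x)) - p * (\<Sum>y<n. \<Sum>x<n. of_bool (x = Suc y))"
    by (subst (3) sum.swap)
      (simp add: sum.distrib sum_subtractf power2_eq_square flip: sum_distrib_left,
        simp add: algebra_simps)
  also have "\<dots> = p * (real n)\<^sup>2 + (2 * p - n * (4 * p - 1))"
    unfolding succ by (simp add: of_bool_def algebra_simps)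
  also have "\<dots> / (real n)\<^sup>2 < p"
    using big n0 by (simp add: divide_less_eq)
  finally show ?thesis
    using n0 \<mu> by blast
qed

section \<open>The accumulation point\<close>

theorem theorem1p5:
  shows "accumulation_point
           (Forb ({complete_bipartite 1 4} \<union> {cycle_graph m | m. m \<ge> 5})) (1 / 4)"
proof -
  let ?\<H> = "Forb star_cycles"
  have "\<not> regular_point ?\<H> (1 / 4)"
  proof
    assume "regular_point ?\<H> (1 / 4)"
    then obtain \<epsilon> \<K> where \<epsilon>: "0 < \<epsilon>" and \<K>: "finite \<K>" "\<K> \<noteq> {}" "\<K> \<subseteq> admissible_crgs ?\<H>"
      and ed: "\<forall>p\<in>{1 / 4 - \<epsilon><..<1 / 4 + \<epsilon>} \<inter> {0..1}.
        ed ?\<H> p = Min ((\<lambda>K. g_crg K p) ` \<K>)"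
      unfolding regular_point_def by blast
    have K: "is_crg K" "\<not> family_maps_to star_cycles K" if "K \<in> \<K>" for K
      using that \<K>(3) unfolding admissible_crgs_Forb[OF simple_star_cycles] by auto
    \<comment> \<open>As \<K> is finite, the right neighborhoods of 1/4 on which its members stay above p have
      a common part. The second bound in the minimum keeps p inside the unit interval.\<close>
    have "\<forall>\<^sub>F p in at_right (1 / 4). p < 1 / 4 + min \<epsilon> (1 / 4)"
      using \<epsilon> by (intro eventually_at_rightI[of _ "1 / 4 + min \<epsilon> (1 / 4)"]) auto
    moreover have "\<forall>\<^sub>F p in at_right (1 / 4). \<forall>K\<in>\<K>. \<forall>\<mu>\<in>prob_masses K. p \<le> crg_form K p \<mu>"
      using K by (intro eventually_ball_finite \<K>(1) ballI eventually_crg_form_ge)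
    ultimately have "\<forall>\<^sub>F p in at_right (1 / 4). 1 / 4 < p \<and> p < 1 / 4 + min \<epsilon> (1 / 4) \<and>
        (\<forall>K\<in>\<K>. \<forall>\<mu>\<in>prob_masses K. p \<le> crg_form K p \<mu>)"
      using eventually_at_right_less by eventually_elim blast
    then obtain p where p: "1 / 4 < p" "p < 1 / 4 + min \<epsilon> (1 / 4)"
      and ge: "\<And>K \<mu>. K \<in> \<K> \<Longrightarrow> \<mu> \<in> prob_masses K \<Longrightarrow> p \<le> crg_form K p \<mu>"
      using eventually_happens'[OF trivial_limit_at_right_real] by blast
    have "p \<le> g_crg K p" if "K \<in> \<K>" for K
      unfolding g_crg_def
      using ge[OF that] prob_masses_nonempty[OF K(1)[OF that]]
      by (intro cINF_greatest) (auto simp: crg_form_def)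
    then have "p \<le> ed ?\<H> p"
      using \<K> p by (subst bspec[OF ed]) auto
    moreover obtain n \<mu> where "0 < n" "\<mu> \<in> prob_masses (gray_path n)"
      "crg_form (gray_path n) p \<mu> < p"
      using gray_path_form_less[OF p(1)] by blast
    moreover from this have "ed ?\<H> p \<le> crg_form (gray_path n) p \<mu>"
      using p by (intro ed_Forb_le_crg_form gray_path_admissible) auto
    ultimately show False by linarith
  qed
  then show ?thesis
    using hereditary_Forb nontrivial_Forb_star_cycles by (simp add: accumulation_point_def)
qed

end
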